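(* Let $2<p\le q<\infty$, and let $\mu$ be a positive Borel measure on $\mathbb{C}_+$ for which there is a constant $C_0>0$ such that $$\mu(Q_I)\le C_0|I|^{q/p'}\quad\text{for all intervals } I\subset\mathbb{R}.$$ Then $\mathcal{L}\colon L^p(\mathbb{R}_+)\to L^q(\mathbb{C}_+,d\mu)$ is bounded, i.e. there is a constant $C>0$ such that $\left(\int_{\mathbb{C}_+}|\mathcal{L}f|^q\,d\mu\right)^{1/q}\le C\|f\|_{L^p(\mathbb{R}_+)}$ for all $f\in L^p(\mathbb{R}_+)$.
   Context: $\mathbb{R}_+=(0,\infty)$ and $\mathbb{C}_+=\{z\in\mathbb{C}:\operatorname{Im}z>0\}$. The conjugate exponent is $p'=p/(p-1)$. The (complex-valued) Laplace transform is $\mathcal{L}f(z)=\int_0^\infty f(t)e^{2\pi i tz}\,dt$ for $z\in\mathbb{C}_+$. For a bounded interval $I\subset\mathbb{R}$ of length $|I|$, the Carleson box is $Q_I=\{x+iy: x\in I,\ 0<y\le|I|\}\subset\mathbb{C}_+$. *)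

theory Defs
  imports "HOL-Analysis.Analysis"
begin

definition upper_half_plane :: "complex set"
  where "upper_half_plane = {z. Im z > 0}"

definition conjugate_exponent :: "real \<Rightarrow> real"
  where "conjugate_exponent p = p / (p - 1)"

(* Elements of L^p are represented by functions, not by classes modulo null sets. *)
definition Lp_space :: "real \<Rightarrow> 'a measure \<Rightarrow> ('a \<Rightarrow> complex) set"
  where "Lp_space p M =
    {f \<in> borel_measurable M. integrable M (\<lambda>x. norm (f x) powr p)}"

(* Only meaningful on Lp_space p M: the Bochner integral is 0 for non-integrable functions. *)
definition Lp_norm :: "real \<Rightarrow> 'a measure \<Rightarrow> ('a \<Rightarrow> complex) \<Rightarrow> real"
  where "Lp_norm p M f = (LINT x|M. norm (f x) powr p) powr (1 / p)"

definition laplace_transform :: "(real \<Rightarrow> complex) \<Rightarrow> complex \<Rightarrow> complex"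
  where "laplace_transform f z =
    (LINT t|lebesgue_on {0<..}. f t * exp (2 * of_real pi * \<i> * of_real t * z))"

(* The length of a bounded interval, of any kind, is its Lebesgue measure. *)
definition carleson_box :: "real set \<Rightarrow> complex set"
  where "carleson_box I = {z. Re z \<in> I \<and> 0 < Im z \<and> Im z \<le> measure lborel I}"

end

theory Submission
  imports Defs
begin

text \<open>
  Write \<open>F\<close> for the Laplace transform of \<open>f\<close> and, for \<open>s > 0\<close>, put
  \<open>A s = \<integral> \<bar>f t\<bar>\<^sup>2 exp (- 2 \<pi> s t) dt\<close> and \<open>B s = \<integral> \<bar>f t\<bar> exp (- 2 \<pi> s t) dt\<close>.
  On the strip \<open>s < Im z \<le> 2 s\<close> trivially \<open>\<bar>F z\<bar> \<le> B s\<close>, and there is a large sieve inequality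
  \<open>\<integral> \<bar>F\<bar>\<^sup>2 d\<mu> \<le> C s powr (q / p' - 1) * A s\<close>, obtained by duality: after inserting a suitable weight the
  kernel of \<open>T T*\<close> decays like \<open>s / (s\<^sup>2 + x\<^sup>2)\<close>, so that Schur's test and the Carleson condition apply.
  Thus \<open>\<bar>F\<bar> powr q \<le> B s powr (q - 2) * \<bar>F\<bar>\<^sup>2\<close>, Hoelder's bound \<open>B s \<le> \<parallel>f\<parallel> s powr (- 1 / p')\<close> for \<open>q - p\<close> of
  the factors \<open>B s\<close>, and Young's inequality reduce the claim to
  \<open>\<integral> B s powr p * s powr (p - 2) ds \<le> C \<parallel>f\<parallel> powr p\<close> and
  \<open>\<integral> A s powr (p / 2) * s powr (p / 2 - 2) ds \<le> C \<parallel>f\<parallel> powr p\<close>. Both are instances of one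
  weighted bound for the real Laplace transform on \<open>L\<^sup>r\<close> with \<open>r > 1\<close>; this is where \<open>p > 2\<close> enters.
\<close>

section \<open>Weighted bounds for the real Laplace transform\<close>

text \<open>Young's inequality applied pointwise to \<open>f / A\<close> and \<open>g / B\<close>,
  where \<open>A\<close> and \<open>B\<close> are the two norms, integrates to
  \<open>1 / p + 1 / q = 1\<close>; without the normalisation it gives integrability of the product.
  If a norm vanishes, so does the product almost everywhere.\<close>

lemma Holder_inequality_integral:
  fixes f g :: "'a \<Rightarrow> real"
  assumes pq: "p > 1" "q > 1" "1 / p + 1 / q = 1"
    and [measurable]: "f \<in> borel_measurable M" "g \<in> borel_measurable M"
    and nonneg: "\<And>x. 0 \<le> f x" "\<And>x. 0 \<le> g x"
    and f: "integrable M (\<lambda>x. f x powr p)" and g: "integrable M (\<lambda>x. g x powr q)"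
  shows "integrable M (\<lambda>x. f x * g x)"
    and "(LINT x|M. f x * g x) \<le> (LINT x|M. f x powr p) powr (1 / p) * (LINT x|M. g x powr q) powr (1 / q)"
proof -
  show int: "integrable M (\<lambda>x. f x * g x)"
  proof (rule Bochner_Integration.integrable_bound)
    show "integrable M (\<lambda>x. f x powr p / p + g x powr q / q)"
      using f g by simp
    show "AE x in M. norm (f x * g x) \<le> norm (f x powr p / p + g x powr q / q)"
      using Youngs_inequality[OF pq nonneg] pq nonneg by (intro AE_I2) (simp add: order_trans[OF _ abs_ge_self])
  qed simp
  define A where "A = (LINT x|M. f x powr p) powr (1 / p)"
  define B where "B = (LINT x|M. g x powr q) powr (1 / q)"
  have A: "A powr p = (LINT x|M. f x powr p)" and B: "B powr q = (LINT x|M. g x powr q)"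
    using pq by (simp_all add: A_def B_def powr_powr)
  have "A \<ge> 0" "B \<ge> 0" by (simp_all add: A_def B_def)
  have zero: "(LINT x|M. f x * g x) = 0" if "A = 0 \<or> B = 0"
  proof -
    have "AE x in M. f x * g x = 0"
      using that
    proof
      assume "A = 0"
      then have "AE x in M. f x powr p = 0"
        using A f pq by (subst integral_nonneg_eq_0_iff_AE[symmetric]) auto
      then show ?thesis by auto
    next
      assume "B = 0"
      then have "AE x in M. g x powr q = 0"
        using B g pq by (subst integral_nonneg_eq_0_iff_AE[symmetric]) auto
      then show ?thesis by auto
    qed
    then show ?thesis by (simp add: integral_eq_zero_AE)
  qed
  have "(LINT x|M. f x * g x) \<le> A * B"
  proof (cases "A = 0 \<or> B = 0")
    case True
    then show ?thesis using zero by auto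
  next
    case False
    with \<open>A \<ge> 0\<close> \<open>B \<ge> 0\<close> have pos: "A > 0" "B > 0" by auto
    have "(f x / A) * (g x / B) \<le> f x powr p / A powr p / p + g x powr q / B powr q / q" for x
      using Youngs_inequality[OF pq, of "f x / A" "g x / B"] nonneg[of x] pos
      by (simp add: powr_divide)
    then have "(LINT x|M. (f x / A) * (g x / B))
        \<le> (LINT x|M. f x powr p / A powr p / p + g x powr q / B powr q / q)"
      using int f g by (intro integral_mono) auto
    also have "\<dots> = 1 / p + 1 / q"
      using f g A B pos by (simp flip: A B)
    finally show ?thesis
      using pq pos by (simp add: field_simps)
  qed
  then show "(LINT x|M. f x * g x) \<le> (LINT x|M. f x powr p) powr (1 / p) * (LINT x|M. g x powr q) powr (1 / q)"
    by (simp add: A_def B_def)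
qed

text \<open>Substitution of \<open>c * t\<close> for \<open>t\<close> in Euler's integral. The case
  \<open>b = 1\<close> serves below as the integral of a decaying exponential, since
  \<open>t powr (1 - 1)\<close> is 1 on the open half-line.\<close>

lemma has_bochner_integral_Gamma_scaled:
  fixes b c :: real
  assumes "0 < b" "0 < c"
  shows "has_bochner_integral lborel (\<lambda>t. indicator {0<..} t * (t powr (b - 1) * exp (- c * t)))
           (Gamma b * c powr (- b))"
proof (rule has_bochner_integral_nn_integral)
  have "ennreal (Gamma b) = (\<integral>\<^sup>+t. ennreal (indicator {0..} t * t powr (b - 1) / exp t) \<partial>lborel)"
    using Gamma_conv_nn_integral_real[OF assms(1)] .
  also have "\<dots> = ennreal c * (\<integral>\<^sup>+t. ennreal (indicator {0..} (c * t) * (c * t) powr (b - 1) / exp (c * t)) \<partial>lborel)"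
    using assms by (subst nn_integral_real_affine[where c=c and t=0]) auto
  also have "\<dots> = (\<integral>\<^sup>+t. ennreal (c powr b) * ennreal (indicator {0<..} t * (t powr (b - 1) * exp (- c * t))) \<partial>lborel)"
    using assms
    by (subst nn_integral_cmult[symmetric], simp)
       (intro nn_integral_cong_AE AE_I[where N="{0}"], auto simp: indicator_def powr_mult exp_minus
          field_simps powr_diff ennreal_mult[symmetric] zero_le_mult_iff)
  also have "\<dots> = ennreal (c powr b) * (\<integral>\<^sup>+t. ennreal (indicator {0<..} t * (t powr (b - 1) * exp (- c * t))) \<partial>lborel)"
    by (rule nn_integral_cmult) simp
  finally have "ennreal (c powr (-b)) * ennreal (Gamma b) = (ennreal (c powr (-b)) * ennreal (c powr b)) *
      (\<integral>\<^sup>+t. ennreal (indicator {0<..} t * (t powr (b - 1) * exp (- c * t))) \<partial>lborel)"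
    by (simp add: mult.assoc)
  moreover have "ennreal (c powr (-b)) * ennreal (c powr b) = 1"
    using assms by (simp add: ennreal_mult[symmetric] powr_minus)
  ultimately show "(\<integral>\<^sup>+t. ennreal (indicator {0<..} t * (t powr (b - 1) * exp (- c * t))) \<partial>lborel)
       = ennreal (Gamma b * c powr - b)"
    using assms by (simp add: ennreal_mult Gamma_real_nonneg mult.commute)
qed (use assms in \<open>auto simp: Gamma_real_nonneg\<close>)

text \<open>A complex rate is needed for the oscillating kernel on the strip. Absolute integrability
  depends on \<open>Re a\<close> only and comes from the Gamma integral; the value comes from an
  antiderivative that tends to \<open>- 1 / a\<close> at 0 and to 0 at infinity.\<close>

lemma exp_has_integral_halfline:
  fixes a :: complex
  assumes "Re a > 0"
  shows "has_bochner_integral lborel (\<lambda>t. indicator {0<..} t *\<^sub>R exp (- a * of_real t)) (1 / a)"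
proof -
  have int: "set_integrable lborel (einterval 0 \<infinity>) (\<lambda>t. exp (- a * of_real t))"
    unfolding set_integrable_def
  proof (rule Bochner_Integration.integrable_bound)
    show "integrable lborel (\<lambda>t. indicator {0<..} t * (t powr (1 - 1) * exp (- Re a * t)))"
      using has_bochner_integral_Gamma_scaled[of 1 "Re a"] assms by (auto simp: has_bochner_integral_iff)
    show "AE t in lborel. norm (indicator (einterval 0 \<infinity>) t *\<^sub>R exp (- a * of_real t))
           \<le> norm (indicator {0<..} t * (t powr (1 - 1) * exp (- Re a * t)))"
      by (auto simp: indicator_def einterval_def norm_exp)
  qed simp
  have a: "a \<noteq> 0" using assms by auto
  have "(LBINT t=0..\<infinity>. exp (- a * of_real t)) = 0 - (- 1 / a)"
  proof (rule interval_integral_FTC_integrable[where F="\<lambda>t. - exp (- a * of_real t) / a"])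
    show "((\<lambda>t. - exp (- a * of_real t) / a) has_vector_derivative exp (- a * of_real x)) (at x)" for x
      using a by (auto intro!: derivative_eq_intros has_vector_derivative_real_field)
    have "((\<lambda>t. - exp (- a * of_real t) / a) \<longlongrightarrow> - exp (- a * of_real 0) / a) (at_right (0::real))"
      using a by (intro tendsto_intros)
    then show "(((\<lambda>t. - exp (- a * of_real t) / a) \<circ> real_of_ereal) \<longlongrightarrow> - 1 / a) (at_right 0)"
      using ereal_tendsto_simps(2)[of "\<lambda>t. - exp (- a * of_real t) / a" "- 1 / a" 0]
      by (simp add: zero_ereal_def)
    have "((\<lambda>t. exp (- Re a * t)) \<longlongrightarrow> 0) at_top"
      using assms by real_asymp
    then have "((\<lambda>t. - exp (- a * of_real t) / a) \<longlongrightarrow> - 0 / a) at_top"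
      using a by (intro tendsto_intros) (auto intro: tendsto_norm_zero_cancel simp: norm_exp)
    then show "(((\<lambda>t. - exp (- a * of_real t) / a) \<circ> real_of_ereal) \<longlongrightarrow> 0) (at_left \<infinity>)"
      by (simp add: ereal_tendsto_simps)
  qed (use int in auto)
  then show ?thesis
    using int by (simp add: has_bochner_integral_iff interval_lebesgue_integral_def set_integrable_def
        set_lebesgue_integral_def einterval_def zero_ereal_def greaterThan_def)
qed

lemma nn_integral_eq_of_has_bochner_integral:
  assumes "has_bochner_integral M f x" "\<And>y. 0 \<le> f y"
  shows "(\<integral>\<^sup>+y. ennreal (f y) \<partial>M) = ennreal x"
  using assms by (simp add: has_bochner_integral_iff nn_integral_eq_integral)

text \<open>Hoelder's inequality with an auxiliary power of \<open>t\<close> bounds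
  \<open>B s powr r\<close> by a power of \<open>s\<close> times the integral \<open>J s\<close>,
  which carries the extra weight \<open>t powr \<beta>\<close>. After Tonelli the integral over
  \<open>s\<close> is a Gamma integral, a multiple of \<open>t powr (- \<beta>)\<close>, and the
  auxiliary weight cancels. Invariance under dilations of \<open>g\<close> dictates the power
  \<open>r - 2\<close> of \<open>s\<close>.\<close>

lemma real_laplace_weighted_bound:
  fixes r :: real
  assumes r: "1 < r"
  obtains C where "C > 0"
    "\<And>g :: real \<Rightarrow> real. g \<in> borel_measurable borel \<Longrightarrow> (\<And>t. 0 \<le> g t) \<Longrightarrow> (\<And>t. t \<le> 0 \<Longrightarrow> g t = 0) \<Longrightarrow>
       (\<integral>\<^sup>+s. ennreal (indicator {0<..} s * ((LINT t|lborel. g t * exp (- 2 * pi * s * t)) powr r * s powr (r - 2))) \<partial>lborel)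
         \<le> ennreal C * (\<integral>\<^sup>+t. ennreal (g t powr r) \<partial>lborel)"
proof
  \<comment> \<open>The argument works for \<open>0 < \<delta> < 1 / r'\<close>: the upper bound
    makes \<open>v powr r'\<close> integrable at 0, and positivity of \<open>\<delta>\<close> makes
    the Gamma integral over \<open>s\<close>, whose parameter is
    \<open>\<beta> = \<delta> * r\<close>, converge. Half of the upper bound is taken.\<close>
  define \<beta> where "\<beta> = (r - 1) / 2"
  define r' where "r' = r / (r - 1)"
  define \<delta> where "\<delta> = (r - 1) / (2 * r)"
  define K where "K = (Gamma (1/2) * (2 * pi) powr (- (1/2))) powr (r - 1)"
  define C where "C = K * (Gamma \<beta> * (2 * pi) powr (- \<beta>))"
  have \<beta>: "\<beta> > 0" and r': "r' > 1" and conj: "1 / r + 1 / r' = 1"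
    using r by (auto simp: \<beta>_def r'_def field_simps)
  have \<delta>r: "\<delta> * r = \<beta>" "\<delta> * r' = 1 / 2"
    using r by (auto simp: \<delta>_def \<beta>_def r'_def field_simps)
  have K: "K > 0" by (simp add: K_def Gamma_one_half_real)
  show "C > 0" using K \<beta> by (simp add: C_def)
  fix g :: "real \<Rightarrow> real"
  assume g_meas [measurable]: "g \<in> borel_measurable borel" and g: "\<And>t. 0 \<le> g t" "\<And>t. t \<le> 0 \<Longrightarrow> g t = 0"
  define B where "B s = (LINT t|lborel. g t * exp (- 2 * pi * s * t))" for s
  define J where "J s = (\<integral>\<^sup>+t. ennreal (g t powr r * t powr \<beta> * exp (- 2 * pi * s * t)) \<partial>lborel)" for s
  have pt: "ennreal (B s powr r) \<le> J s * ennreal (K * s powr (- \<beta>))" if s: "s > 0" for s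
  proof (cases "integrable lborel (\<lambda>t. g t powr r * t powr \<beta> * exp (- 2 * pi * s * t))")
    \<comment> \<open>Here \<open>J s\<close> is infinite and its factor is positive, so the
      right-hand side is infinite.\<close>
    case False
    then have "J s = \<infinity>"
      unfolding J_def by (auto simp: integrable_iff_bounded less_top[symmetric] abs_mult)
    then show ?thesis using K s by (simp add: ennreal_top_mult)
  next
    case True
    define u where "u t = g t * t powr \<delta> * exp (- 2 * pi * s * t / r)" for t
    define v where "v t = indicator {0<..} t * t powr (- \<delta>) * exp (- 2 * pi * s * t / r')" for t :: real
    have u_powr: "u t powr r = g t powr r * t powr \<beta> * exp (- 2 * pi * s * t)" for t
      using r g by (simp add: u_def powr_mult powr_powr \<delta>r exp_powr_real)
    have v_powr: "v t powr r' = indicator {0<..} t * (t powr (1/2 - 1) * exp (- (2 * pi * s) * t))" for t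
      using r' by (auto simp: v_def powr_mult powr_powr \<delta>r exp_powr_real indicator_def)
    have uv: "u t * v t = g t * exp (- 2 * pi * s * t)" for t
    proof (cases "t > 0")
      case True
      have "u t * v t = g t * (t powr \<delta> * t powr (- \<delta>)) * (exp (- 2 * pi * s * t / r) * exp (- 2 * pi * s * t / r'))"
        using True by (simp add: u_def v_def)
      also have "exp (- 2 * pi * s * t / r) * exp (- 2 * pi * s * t / r') = exp (- 2 * pi * s * t * (1 / r + 1 / r'))"
        by (simp add: exp_add[symmetric] algebra_simps)
      also have "t powr \<delta> * t powr (- \<delta>) = 1"
        using True by (simp add: powr_minus)
      finally show ?thesis by (simp add: conj)
    qed (use g in \<open>auto simp: u_def\<close>)
    have hv: "has_bochner_integral lborel (\<lambda>t. v t powr r') (Gamma (1/2) * (2 * pi * s) powr (- (1/2)))"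
      unfolding v_powr using has_bochner_integral_Gamma_scaled[of "1/2" "2 * pi * s"] s by simp
    have [measurable]: "u \<in> borel_measurable borel" "v \<in> borel_measurable borel"
      by (simp_all add: u_def[abs_def] v_def[abs_def])
    have H: "B s \<le> (LINT t|lborel. u t powr r) powr (1 / r) * (LINT t|lborel. v t powr r') powr (1 / r')"
      unfolding B_def uv[symmetric]
      by (rule Holder_inequality_integral(2)[OF r r' conj])
         (use True hv g in \<open>auto simp: u_powr has_bochner_integral_iff\<close>, auto simp: u_def v_def g)
    have B0: "B s \<ge> 0" unfolding B_def using g by (intro integral_nonneg_AE) auto
    have I0: "0 \<le> (LINT t|lborel. u t powr r)" by simp
    have "B s powr r \<le> ((LINT t|lborel. u t powr r) powr (1 / r) * (LINT t|lborel. v t powr r') powr (1 / r')) powr r"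
      using H B0 r by (intro powr_mono2) auto
    also have "\<dots> = (LINT t|lborel. u t powr r) * (LINT t|lborel. v t powr r') powr (r / r')"
      using r I0 by (simp add: powr_mult powr_powr)
    also have "r / r' = r - 1" using r by (simp add: r'_def)
    also have "(LINT t|lborel. v t powr r') powr (r - 1) = K * s powr (- \<beta>)"
      using hv s by (simp add: has_bochner_integral_iff K_def \<beta>_def powr_mult powr_powr field_simps)
    finally have "ennreal (B s powr r) \<le> ennreal ((LINT t|lborel. u t powr r) * (K * s powr (- \<beta>)))"
      by (rule ennreal_leI)
    also have "\<dots> = ennreal (LINT t|lborel. u t powr r) * ennreal (K * s powr (- \<beta>))"
      using K by (intro ennreal_mult) auto
    also have "ennreal (LINT t|lborel. u t powr r) = J s"
      unfolding J_def u_powr[symmetric] using True by (intro nn_integral_eq_integral[symmetric]) (auto simp: u_powr)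
    finally show ?thesis .
  qed
  have "(\<integral>\<^sup>+s. ennreal (indicator {0<..} s * (B s powr r * s powr (r - 2))) \<partial>lborel)
      \<le> (\<integral>\<^sup>+s. (\<integral>\<^sup>+t. ennreal (g t powr r * t powr \<beta> * K) *
             ennreal (indicator {0<..} s * (s powr (\<beta> - 1) * exp (- (2 * pi * t) * s))) \<partial>lborel) \<partial>lborel)"
  proof (rule nn_integral_mono)
    fix s :: real
    show "ennreal (indicator {0<..} s * (B s powr r * s powr (r - 2))) \<le>
        (\<integral>\<^sup>+t. ennreal (g t powr r * t powr \<beta> * K) *
             ennreal (indicator {0<..} s * (s powr (\<beta> - 1) * exp (- (2 * pi * t) * s))) \<partial>lborel)"
    proof (cases "s > 0")
      case s: True
      have "ennreal (indicator {0<..} s * (B s powr r * s powr (r - 2))) = ennreal (B s powr r) * ennreal (s powr (r - 2))"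
        using s by (simp add: ennreal_mult)
      also have "\<dots> \<le> (J s * ennreal (K * s powr (- \<beta>))) * ennreal (s powr (r - 2))"
        using pt[OF s] by (intro mult_right_mono) auto
      also have "\<dots> = J s * ennreal (K * s powr (\<beta> - 1))"
      proof -
        \<comment> \<open>The exponents agree because \<open>2 * \<beta> = r - 1\<close>.\<close>
        have "s powr (- \<beta>) * s powr (r - 2) = s powr (\<beta> - 1)"
          unfolding powr_add[symmetric] by (simp add: \<beta>_def field_simps)
        then show ?thesis using K
          by (simp add: mult.assoc ennreal_mult[symmetric])
      qed
      also have "\<dots> = (\<integral>\<^sup>+t. ennreal (g t powr r * t powr \<beta> * exp (- 2 * pi * s * t)) * ennreal (K * s powr (\<beta> - 1)) \<partial>lborel)"
        unfolding J_def by (rule nn_integral_multc[symmetric]) simp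
      also have "\<dots> = (\<integral>\<^sup>+t. ennreal (g t powr r * t powr \<beta> * K) *
             ennreal (indicator {0<..} s * (s powr (\<beta> - 1) * exp (- (2 * pi * t) * s))) \<partial>lborel)"
        using s K by (intro nn_integral_cong) (simp add: ennreal_mult[symmetric] ac_simps)
      finally show ?thesis .
    qed simp
  qed
  also have "\<dots> = (\<integral>\<^sup>+t. (\<integral>\<^sup>+s. ennreal (g t powr r * t powr \<beta> * K) *
             ennreal (indicator {0<..} s * (s powr (\<beta> - 1) * exp (- (2 * pi * t) * s))) \<partial>lborel) \<partial>lborel)"
    by (rule lborel_pair.Fubini') simp
  also have "\<dots> = (\<integral>\<^sup>+t. ennreal C * ennreal (g t powr r) \<partial>lborel)"
  proof (rule nn_integral_cong)
    fix t :: real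
    show "(\<integral>\<^sup>+s. ennreal (g t powr r * t powr \<beta> * K) *
             ennreal (indicator {0<..} s * (s powr (\<beta> - 1) * exp (- (2 * pi * t) * s))) \<partial>lborel)
          = ennreal C * ennreal (g t powr r)"
    proof (cases "t > 0")
      case t: True
      have "(\<integral>\<^sup>+s. ennreal (indicator {0<..} s * (s powr (\<beta> - 1) * exp (- (2 * pi * t) * s))) \<partial>lborel)
          = ennreal (Gamma \<beta> * (2 * pi * t) powr (- \<beta>))"
        using t \<beta> by (intro nn_integral_eq_of_has_bochner_integral has_bochner_integral_Gamma_scaled) auto
      moreover have "t powr \<beta> * (2 * pi * t) powr (- \<beta>) = (2 * pi) powr (- \<beta>)"
        using t by (simp add: powr_mult powr_minus)
      moreover have "g t powr r * t powr \<beta> * K * (Gamma \<beta> * (2 * pi * t) powr (- \<beta>))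
          = K * Gamma \<beta> * (t powr \<beta> * (2 * pi * t) powr (- \<beta>)) * g t powr r"
        by (simp only: ac_simps)
      ultimately show ?thesis using t K \<beta>
        by (subst nn_integral_cmult)
           (simp_all add: C_def Gamma_real_nonneg mult.assoc del: times_divide_eq_right flip: ennreal_mult)
    qed (use g in auto)
  qed
  also have "\<dots> = ennreal C * (\<integral>\<^sup>+t. ennreal (g t powr r) \<partial>lborel)"
    by (rule nn_integral_cmult) simp
  finally show "(\<integral>\<^sup>+s. ennreal (indicator {0<..} s * ((LINT t|lborel. g t * exp (- 2 * pi * s * t)) powr r * s powr (r - 2))) \<partial>lborel)
         \<le> ennreal C * (\<integral>\<^sup>+t. ennreal (g t powr r) \<partial>lborel)"
    unfolding B_def .
qed

section \<open>The large sieve inequality on a strip\<close>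

text \<open>
  The mass on the negative half-line, where \<open>f\<close> vanishes, only serves to remove the jump
  of the weight at 0 (the value at the point 0 itself is irrelevant). This improves the decay of its Fourier transform from \<open>1 / \<bar>x\<bar>\<close>
  to \<open>1 / x\<^sup>2\<close> and makes Schur's test applicable.
\<close>

definition strip_weight :: "real \<Rightarrow> real \<Rightarrow> real"
  where "strip_weight s t = indicator {0<..} t * exp (2 * pi * s * t) + indicator {..<0} t * exp (10 * pi * s * t)"

text \<open>The two half-lines contribute \<open>1 / a\<close> and \<open>1 / b\<close>. With
  \<open>Y = Im z + Im w\<close> between \<open>2 * s\<close> and \<open>4 * s\<close>, the growth
  rates \<open>s\<close> and \<open>5 * s\<close> of the weight keep both \<open>Y - s\<close> and
  \<open>5 * s - Y\<close> at least \<open>s\<close>, so both integrals converge and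
  \<open>a\<close>, \<open>b\<close> have modulus at least
  \<open>2 * pi * sqrt (s\<^sup>2 + X\<^sup>2)\<close>. The parts containing \<open>X\<close> cancel
  in \<open>a + b\<close>, and so \<open>(a + b) / (a * b)\<close> decays quadratically.\<close>

lemma strip_kernel_bound:
  fixes z w :: complex
  assumes s: "0 < s" and z: "s < Im z" "Im z \<le> 2 * s" and w: "s < Im w" "Im w \<le> 2 * s"
  shows "norm (LINT t|lborel. of_real (strip_weight s t) * exp (2 * of_real pi * \<i> * of_real t * (z - cnj w)))
           \<le> (2 / pi) * (s / (s\<^sup>2 + (Re z - Re w)\<^sup>2))"
proof -
  define X where "X = Re z - Re w"
  define Y where "Y = Im z + Im w"
  have zw: "z - cnj w = Complex X Y" by (simp add: complex_eq_iff X_def Y_def)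
  define a where "a = complex_of_real (2 * pi) * Complex (Y - s) (- X)"
  define b where "b = complex_of_real (2 * pi) * Complex (5 * s - Y) X"
  have Y: "2 * s < Y" "Y \<le> 4 * s" using z w by (auto simp: Y_def)
  have ab: "Re a > 0" "Re b > 0" using Y s by (auto simp: a_def b_def)
  then have ab0: "a \<noteq> 0" "b \<noteq> 0" by auto
  have "has_bochner_integral lborel (\<lambda>t. indicator {0<..} t *\<^sub>R exp (- a * of_real t)) (1 / a)"
    by (rule exp_has_integral_halfline) fact
  moreover have "has_bochner_integral lborel (\<lambda>t. indicator {0<..} (0 + (-1) * t) *\<^sub>R exp (- b * of_real (0 + (-1) * t))) ((1 / b) /\<^sub>R \<bar>-1\<bar>)"
    using exp_has_integral_halfline[OF ab(2)] by (subst lborel_has_bochner_integral_real_affine_iff[symmetric]) auto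
  ultimately have "has_bochner_integral lborel (\<lambda>t. indicator {0<..} t *\<^sub>R exp (- a * of_real t)
       + indicator {0<..} (0 + (-1) * t) *\<^sub>R exp (- b * of_real (0 + (-1) * t))) (1 / a + (1 / b) /\<^sub>R \<bar>-1\<bar>)"
    by (rule has_bochner_integral_add)
  moreover have "indicator {0<..} t *\<^sub>R exp (- a * of_real t)
       + indicator {0<..} (0 + (-1) * t) *\<^sub>R exp (- b * of_real (0 + (-1) * t))
       = of_real (strip_weight s t) * exp (2 * of_real pi * \<i> * of_real t * (z - cnj w))" for t
  proof -
    have "- a * of_real t = of_real (2 * pi * s * t) + 2 * of_real pi * \<i> * of_real t * (z - cnj w)"
      by (simp add: zw a_def complex_eq_iff algebra_simps)
    moreover have "b * of_real t = of_real (10 * pi * s * t) + 2 * of_real pi * \<i> * of_real t * (z - cnj w)"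
      by (simp add: zw b_def complex_eq_iff algebra_simps)
    ultimately show ?thesis
      by (auto simp: strip_weight_def indicator_def exp_add simp flip: exp_of_real)
  qed
  ultimately have I: "(LINT t|lborel. of_real (strip_weight s t) * exp (2 * of_real pi * \<i> * of_real t * (z - cnj w))) = 1 / a + 1 / b"
    by (simp add: has_bochner_integral_iff)
  have sum: "a + b = of_real (8 * pi * s)"
    by (simp add: a_def b_def complex_eq_iff algebra_simps)
  have "1 / a + 1 / b = (a + b) / (a * b)"
    using ab0 by (simp add: field_simps)
  then have "norm (1 / a + 1 / b) = 8 * pi * s / (norm a * norm b)"
    using s by (simp only: sum norm_divide norm_mult norm_of_real) simp
  also have "norm a * norm b \<ge> (2 * pi * sqrt (s\<^sup>2 + X\<^sup>2)) * (2 * pi * sqrt (s\<^sup>2 + X\<^sup>2))"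
  proof (rule mult_mono)
    have "s\<^sup>2 \<le> (Y - s)\<^sup>2" "s\<^sup>2 \<le> (5 * s - Y)\<^sup>2" using Y s by (auto intro!: power_mono)
    then show "2 * pi * sqrt (s\<^sup>2 + X\<^sup>2) \<le> norm a" "2 * pi * sqrt (s\<^sup>2 + X\<^sup>2) \<le> norm b"
      unfolding a_def b_def norm_mult norm_of_real
      by (auto simp: cmod_def intro!: mult_left_mono)
  qed auto
  then have "8 * pi * s / (norm a * norm b) \<le> 8 * pi * s / ((2 * pi * sqrt (s\<^sup>2 + X\<^sup>2)) * (2 * pi * sqrt (s\<^sup>2 + X\<^sup>2)))"
    using s ab0 by (intro divide_left_mono mult_pos_pos) (auto intro!: add_pos_nonneg)
  also have "\<dots> = 8 * pi * s / (4 * pi * pi * (s\<^sup>2 + X\<^sup>2))"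
    by (simp add: power2_eq_square)
  also have "\<dots> = (2 / pi) * (s / (s\<^sup>2 + X\<^sup>2))"
    by simp
  finally show ?thesis unfolding I X_def .
qed

section \<open>Duality and Schur's test for a finite measure on a strip\<close>

abbreviation laplace_kernel :: "real \<Rightarrow> complex \<Rightarrow> complex"
  where "laplace_kernel t z \<equiv> exp (2 * of_real pi * \<i> * of_real t * z)"

lemma norm_laplace_kernel: "norm (laplace_kernel t z) = exp (- 2 * pi * t * Im z)"
  by (simp add: norm_exp)

lemma borel_measurable_laplace [measurable]:
  fixes h :: "real \<Rightarrow> complex"
  assumes [measurable]: "h \<in> borel_measurable borel"
  shows "(\<lambda>z. LINT t|lborel. h t * laplace_kernel t z) \<in> borel_measurable borel"
proof -
  have "(\<lambda>(z, t). h t * laplace_kernel t z) \<in> borel_measurable (borel \<Otimes>\<^sub>M lborel)"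
    by measurable
  then show ?thesis by (rule lborel.borel_measurable_lebesgue_integral)
qed

text \<open>The modulus of the kernel decreases in \<open>Im z\<close> for \<open>t > 0\<close>. For
  negative \<open>t\<close> the comparison would be reversed, but there \<open>h\<close>
  vanishes.\<close>

lemma norm_laplace_le:
  fixes h :: "real \<Rightarrow> complex"
  assumes [measurable]: "h \<in> borel_measurable borel" and h0: "\<And>t. t \<le> 0 \<Longrightarrow> h t = 0"
    and int: "integrable lborel (\<lambda>t. norm (h t) * exp (- 2 * pi * s * t))" and z: "s \<le> Im z"
  shows "integrable lborel (\<lambda>t. h t * laplace_kernel t z)"
    and "norm (LINT t|lborel. h t * laplace_kernel t z) \<le> (LINT t|lborel. norm (h t) * exp (- 2 * pi * s * t))"
proof -
  have bd: "norm (h t * laplace_kernel t z) \<le> norm (h t) * exp (- 2 * pi * s * t)" for t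
  proof (cases "t > 0")
    case True
    with z have "s * t \<le> Im z * t" by (intro mult_right_mono) auto
    then show ?thesis by (auto simp: norm_mult norm_laplace_kernel mult.commute mult.left_commute intro!: mult_left_mono)
  qed (simp add: h0)
  show *: "integrable lborel (\<lambda>t. h t * laplace_kernel t z)"
    by (rule Bochner_Integration.integrable_bound[OF int])
       (use bd in \<open>auto intro!: AE_I2 order_trans[OF _ abs_ge_self]\<close>)
  show "norm (LINT t|lborel. h t * laplace_kernel t z) \<le> (LINT t|lborel. norm (h t) * exp (- 2 * pi * s * t))"
    by (rule order_trans[OF integral_norm_bound integral_mono]) (use * int bd in auto)
qed

lemma integrable_exp_neg_abs:
  fixes c :: real
  assumes "0 < c"
  shows "integrable lborel (\<lambda>t. exp (- c * \<bar>t\<bar>))"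
proof -
  define f where "f t = indicator {0<..} t * (t powr (1 - 1) * exp (- c * t))" for t :: real
  have f: "integrable lborel f"
    using has_bochner_integral_Gamma_scaled[of 1 c] assms by (simp add: has_bochner_integral_iff f_def[abs_def])
  then have "integrable lborel (\<lambda>t. f (0 + (-1) * t))"
    by (rule lborel_integrable_real_affine) simp
  with f have "integrable lborel (\<lambda>t. f t + f (0 + (-1) * t))" by simp
  then show ?thesis
  proof (rule Bochner_Integration.integrable_bound)
    \<comment> \<open>At 0 both halves of the majorant vanish, so the domination fails at this
      single point.\<close>
    show "AE t in lborel. norm (exp (- c * \<bar>t\<bar>)) \<le> norm (f t + f (0 + (-1) * t))"
      using AE_lborel_singleton[of 0] by eventually_elim (auto simp: f_def indicator_def)
  qed simp
qed

text \<open>By duality the square integral \<open>J\<close> of \<open>F\<close> equals the integral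
  of \<open>h * G\<close>, where \<open>G\<close> is the adjoint transform of \<open>F\<close>. The
  weighted arithmetic-geometric inequality with parameter \<open>\<Lambda>\<close> bounds it by
  \<open>\<Lambda> / 2\<close> times the integral of \<open>h\<close> on the right-hand side plus
  \<open>1 / (2 * \<Lambda>)\<close> times the weighted square integral of \<open>G\<close>. The
  latter is at most \<open>\<Lambda> * J\<close> by Schur's test, so half of \<open>J\<close> is
  absorbed. Finiteness of \<open>\<nu>\<close> makes \<open>J\<close> finite and justifies the
  exchanges of integrals. Measurability is expressed through the identity map because
  \<open>\<nu>\<close> will live on a piece of the strip.\<close>

lemma laplace_L2_strip_bound:
  fixes h :: "real \<Rightarrow> complex" and \<nu> :: "complex measure"
  assumes fin: "finite_measure \<nu>" and id_meas: "(\<lambda>z. z) \<in> \<nu> \<rightarrow>\<^sub>M borel"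
    and s: "0 < s" and strip: "\<And>z. z \<in> space \<nu> \<Longrightarrow> s < Im z \<and> Im z \<le> 2 * s"
    and h_meas [measurable]: "h \<in> borel_measurable borel" and h0: "\<And>t. t \<le> 0 \<Longrightarrow> h t = 0"
    and h1: "integrable lborel (\<lambda>t. norm (h t) * exp (- 2 * pi * s * t))"
    and h2: "integrable lborel (\<lambda>t. (norm (h t))\<^sup>2 * exp (- 2 * pi * s * t))"
    and M: "0 < M" "\<And>z. z \<in> space \<nu> \<Longrightarrow> (LINT w|\<nu>. s / (s\<^sup>2 + (Re z - Re w)\<^sup>2)) \<le> M"
  defines "F \<equiv> \<lambda>z. LINT t|lborel. h t * laplace_kernel t z"
  shows "(LINT z|\<nu>. (norm (F z))\<^sup>2) \<le> (2 / pi) * M * (LINT t|lborel. (norm (h t))\<^sup>2 * exp (- 2 * pi * s * t))"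
proof -
  interpret \<nu>: finite_measure \<nu> by (rule fin)
  interpret \<nu>\<nu>: pair_sigma_finite \<nu> \<nu> ..
  interpret \<nu>\<nu>': finite_measure "\<nu> \<Otimes>\<^sub>M \<nu>" by (intro finite_measure_pair_measure fin)
  interpret \<nu>L: pair_sigma_finite \<nu> lborel ..
  interpret PL: pair_sigma_finite "\<nu> \<Otimes>\<^sub>M \<nu>" lborel ..
  define B where "B = (LINT t|lborel. norm (h t) * exp (- 2 * pi * s * t))"
  define \<Lambda> where "\<Lambda> = (2 / pi) * M"
  define J where "J = (LINT z|\<nu>. (norm (F z))\<^sup>2)"
  define G where "G t = (LINT z|\<nu>. cnj (F z) * laplace_kernel t z)" for t
  have \<Lambda>: "\<Lambda> > 0" using M by (simp add: \<Lambda>_def)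
  have F_bd: "norm (F z) \<le> B" if "z \<in> space \<nu>" for z
    unfolding F_def B_def using strip[OF that] by (intro norm_laplace_le h0 h1) auto
  have B0: "B \<ge> 0" unfolding B_def by (intro integral_nonneg_AE) auto
  have "F \<in> borel_measurable borel" unfolding F_def by measurable
  then have F_meas [measurable]: "F \<in> borel_measurable \<nu>"
    using measurable_compose[OF id_meas] by blast
  have Re_meas [measurable]: "Re \<in> borel_measurable \<nu>" "Im \<in> borel_measurable \<nu>"
    using measurable_compose[OF id_meas borel_measurable_Re] measurable_compose[OF id_meas borel_measurable_Im] by auto
  have cnj_meas [measurable]: "cnj \<in> borel_measurable borel"
    by (intro borel_measurable_continuous_onI continuous_intros)
  have proj_meas [measurable]:
    "fst \<in> borel_measurable (\<nu> \<Otimes>\<^sub>M (lborel :: real measure))"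
    "fst \<in> borel_measurable (\<nu> \<Otimes>\<^sub>M \<nu>)" "snd \<in> borel_measurable (\<nu> \<Otimes>\<^sub>M \<nu>)"
    "snd \<in> borel_measurable ((borel :: real measure) \<Otimes>\<^sub>M \<nu>)"
    "(\<lambda>x. fst (fst x)) \<in> borel_measurable ((\<nu> \<Otimes>\<^sub>M \<nu>) \<Otimes>\<^sub>M (lborel :: real measure))"
    "(\<lambda>x. snd (fst x)) \<in> borel_measurable ((\<nu> \<Otimes>\<^sub>M \<nu>) \<Otimes>\<^sub>M (lborel :: real measure))"
    using measurable_compose[OF _ id_meas] by measurable
  have F2_int: "integrable \<nu> (\<lambda>z. (norm (F z))\<^sup>2)"
  proof (rule \<nu>.integrable_const_bound)
    show "AE z in \<nu>. norm ((norm (F z))\<^sup>2) \<le> B\<^sup>2"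
      using F_bd by (intro AE_I2) (simp add: power_mono)
  qed measurable

  have E_bd: "norm (laplace_kernel t z) \<le> exp (- 2 * pi * s * t)" if "z \<in> space \<nu>" "t > 0" for t z
    unfolding norm_laplace_kernel using strip[OF that(1)] that(2) by (auto simp: mult.commute)

  have J_eq: "complex_of_real J = (LINT t|lborel. h t * G t)"
  proof -
    have "complex_of_real J = (LINT z|\<nu>. (LINT t|lborel. cnj (F z) * (h t * laplace_kernel t z)))"
    proof -
      have "complex_of_real J = (LINT z|\<nu>. complex_of_real ((norm (F z))\<^sup>2))"
        unfolding J_def using F2_int by (rule integral_of_real[symmetric])
      also have "\<dots> = (LINT z|\<nu>. cnj (F z) * F z)"
        by (simp only: complex_norm_square mult.commute)
      finally show ?thesis
        by (simp add: F_def)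
    qed
    also have "\<dots> = (LINT t|lborel. (LINT z|\<nu>. cnj (F z) * (h t * laplace_kernel t z)))"
    proof (rule \<nu>L.Fubini_integral[symmetric])
      have meas: "(\<lambda>(z, t). cnj (F z) * (h t * laplace_kernel t z)) \<in> borel_measurable (\<nu> \<Otimes>\<^sub>M lborel)"
        by measurable
      show "integrable (\<nu> \<Otimes>\<^sub>M lborel) (\<lambda>(z, t). cnj (F z) * (h t * laplace_kernel t z))"
      proof (rule Bochner_Integration.integrable_bound)
        \<comment> \<open>The majorant is constant in \<open>z\<close>, hence integrable because
          \<open>\<nu>\<close> is finite.\<close>
        show "integrable (\<nu> \<Otimes>\<^sub>M lborel) (\<lambda>(z, t). B * (norm (h t) * exp (- 2 * pi * s * t)))"
          using h1 by (intro \<nu>L.Fubini_integrable) auto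
        show "AE x in \<nu> \<Otimes>\<^sub>M lborel. norm (case x of (z, t) \<Rightarrow> cnj (F z) * (h t * laplace_kernel t z))
                \<le> norm (case x of (z, t) \<Rightarrow> B * (norm (h t) * exp (- 2 * pi * s * t)))"
        proof (intro AE_I2, clarify)
          fix z and t :: real assume "(z, t) \<in> space (\<nu> \<Otimes>\<^sub>M lborel)"
          then have z: "z \<in> space \<nu>" by (simp add: space_pair_measure)
          show "norm (cnj (F z) * (h t * laplace_kernel t z)) \<le> norm (B * (norm (h t) * exp (- 2 * pi * s * t)))"
          proof (cases "t > 0")
            case True
            have "norm (F z) * (norm (h t) * norm (laplace_kernel t z)) \<le> B * (norm (h t) * exp (- 2 * pi * s * t))"
              using F_bd[OF z] E_bd[OF z True] B0 by (intro mult_mono) auto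
            then show ?thesis using B0 by (simp add: norm_mult abs_mult)
          qed (simp add: h0)
        qed
      qed (rule meas)
    qed
    also have "\<dots> = (LINT t|lborel. h t * G t)"
    proof -
      have "(LINT z|\<nu>. cnj (F z) * (h t * laplace_kernel t z)) = h t * G t" for t
        unfolding G_def integral_mult_right_zero[symmetric] by (simp only: mult.left_commute)
      then show ?thesis by simp
    qed
    finally show ?thesis .
  qed

  \<comment> \<open>\<open>\<Phi>\<close> arises by expanding the square in \<open>Q t\<close> as a
    double integral over \<open>\<nu>\<close>: the kernel at \<open>z\<close> times the conjugate
    kernel at \<open>w\<close> is the kernel at \<open>z - cnj w\<close>.\<close>
  define Q where "Q t = strip_weight s t * (norm (G t))\<^sup>2" for t
  define \<Phi> where "\<Phi> = (\<lambda>(z, w) t. cnj (F z) * F w * (of_real (strip_weight s t) * laplace_kernel t (z - cnj w)))"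
  have sw_meas [measurable]: "strip_weight s \<in> borel_measurable borel"
    unfolding strip_weight_def[abs_def] by measurable
  have sw0: "strip_weight s t \<ge> 0" for t by (simp add: strip_weight_def)
  \<comment> \<open>The rates \<open>s\<close> and \<open>5 * s\<close> of the weight lie on either
    side of \<open>y\<close>, each at distance at least \<open>s\<close>; at \<open>t = 0\<close>
    the weight is 0.\<close>
  have sw_bd: "strip_weight s t * exp (- 2 * pi * t * y) \<le> exp (- 2 * pi * s * \<bar>t\<bar>)"
    if "2 * s < y" "y \<le> 4 * s" for t y
  proof -
    consider "t = 0" | "t > 0" | "t < 0" by linarith
    then show ?thesis
    proof cases
      case 2
      then have "t * (2 * s) \<le> t * y" using that by (intro mult_left_mono) auto
      with 2 show ?thesis by (simp add: strip_weight_def exp_add[symmetric] algebra_simps)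
    next
      case 3
      then have "t * (4 * s) \<le> t * y" using that by (intro mult_left_mono_neg) auto
      with 3 show ?thesis by (simp add: strip_weight_def exp_add[symmetric] algebra_simps)
    qed (simp add: strip_weight_def)
  qed
  have abs_int: "integrable lborel (\<lambda>t. exp (- 2 * pi * s * \<bar>t\<bar>))"
    using integrable_exp_neg_abs[of "2 * pi * s"] s by simp
  have \<Phi>_meas [measurable]: "case_prod \<Phi> \<in> borel_measurable ((\<nu> \<Otimes>\<^sub>M \<nu>) \<Otimes>\<^sub>M lborel)"
    unfolding \<Phi>_def split_beta by measurable
  have \<Phi>_bd: "norm (\<Phi> (z, w) t) \<le> B * B * exp (- 2 * pi * s * \<bar>t\<bar>)"
    if z: "z \<in> space \<nu>" and w: "w \<in> space \<nu>" for z w t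
  proof -
    have "norm (F z) * norm (F w) * (strip_weight s t * exp (- 2 * pi * t * (Im z + Im w))) \<le> B * B * exp (- 2 * pi * s * \<bar>t\<bar>)"
      using F_bd z w B0 sw0 strip[OF z] strip[OF w] by (intro mult_mono sw_bd) auto
    then show ?thesis
      using sw0 by (simp add: \<Phi>_def norm_mult norm_laplace_kernel)
  qed
  have \<Phi>_int: "integrable ((\<nu> \<Otimes>\<^sub>M \<nu>) \<Otimes>\<^sub>M lborel) (case_prod \<Phi>)"
  proof (rule Bochner_Integration.integrable_bound)
    show "integrable ((\<nu> \<Otimes>\<^sub>M \<nu>) \<Otimes>\<^sub>M lborel) (\<lambda>(p, t). B * B * exp (- 2 * pi * s * \<bar>t\<bar>))"
      using abs_int by (intro PL.Fubini_integrable) auto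
    show "AE x in (\<nu> \<Otimes>\<^sub>M \<nu>) \<Otimes>\<^sub>M lborel. norm (case_prod \<Phi> x) \<le> norm (case x of (p, t) \<Rightarrow> B * B * exp (- 2 * pi * s * \<bar>t\<bar>))"
      using \<Phi>_bd by (intro AE_I2) (auto simp: space_pair_measure intro: order_trans[OF _ abs_ge_self])
  qed (rule \<Phi>_meas)
  have Q_eq: "complex_of_real (Q t) = (LINT p|(\<nu> \<Otimes>\<^sub>M \<nu>). \<Phi> p t)" for t
  proof -
    have "integrable (\<nu> \<Otimes>\<^sub>M \<nu>) (\<lambda>p. \<Phi> p t)"
    proof (rule \<nu>\<nu>'.integrable_const_bound)
      show "AE p in \<nu> \<Otimes>\<^sub>M \<nu>. norm (\<Phi> p t) \<le> B * B * exp (- 2 * pi * s * \<bar>t\<bar>)"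
        using \<Phi>_bd by (auto simp: space_pair_measure intro!: AE_I2)
      show "(\<lambda>p. \<Phi> p t) \<in> borel_measurable (\<nu> \<Otimes>\<^sub>M \<nu>)"
        unfolding \<Phi>_def split_beta by measurable
    qed
    then have "(LINT p|(\<nu> \<Otimes>\<^sub>M \<nu>). \<Phi> p t) = (LINT z|\<nu>. (LINT w|\<nu>. \<Phi> (z, w) t))"
      by (rule \<nu>\<nu>.integral_fst'[symmetric])
    also have "\<dots> = (LINT z|\<nu>. of_real (strip_weight s t) * (cnj (F z) * laplace_kernel t z) * cnj (G t))"
    proof (rule Bochner_Integration.integral_cong[OF refl])
      fix z
      have "\<Phi> (z, w) t = of_real (strip_weight s t) * (cnj (F z) * laplace_kernel t z) * cnj (cnj (F w) * laplace_kernel t w)" for w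
      proof -
        have "laplace_kernel t (z - cnj w) = laplace_kernel t z * cnj (laplace_kernel t w)"
          by (simp add: exp_cnj exp_add[symmetric] algebra_simps)
        then show ?thesis by (simp add: \<Phi>_def ac_simps)
      qed
      then have "(LINT w|\<nu>. \<Phi> (z, w) t) = of_real (strip_weight s t) * (cnj (F z) * laplace_kernel t z) *
          (LINT w|\<nu>. cnj (cnj (F w) * laplace_kernel t w))"
        by (simp only: integral_mult_right_zero)
      then show "(LINT w|\<nu>. \<Phi> (z, w) t) = of_real (strip_weight s t) * (cnj (F z) * laplace_kernel t z) * cnj (G t)"
        by (simp only: Bochner_Integration.integral_cnj G_def)
    qed
    also have "\<dots> = of_real (strip_weight s t) * (G t * cnj (G t))"
      by (simp only: integral_mult_right_zero integral_mult_left_zero G_def[symmetric]) (simp only: mult.assoc)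
    also have "\<dots> = complex_of_real (Q t)"
      by (simp add: Q_def complex_norm_square flip: complex_norm_square)
    finally show ?thesis ..
  qed
  have Q_int: "integrable lborel Q"
    using PL.integrable_snd[OF \<Phi>_int] unfolding Q_eq[symmetric] by (simp add: complex_of_real_integrable_eq)
  \<comment> \<open>Schur's test. Integrating \<open>\<Phi>\<close> over \<open>t\<close> first
    produces the strip kernel, bounded by a multiple of \<open>\<kappa>\<close>. The product of the
    two values of \<open>F\<close> is split by \<open>2 * x * y \<le> x\<^sup>2 + y\<^sup>2\<close>;
    by symmetry of \<open>\<kappa>\<close> both halves have the same integral, and in each the inner
    integral of \<open>\<kappa>\<close> is at most \<open>M\<close>.\<close>
  have Q_le: "(LINT t|lborel. Q t) \<le> \<Lambda> * J"
  proof -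
    define \<kappa> where "\<kappa> z w = s / (s\<^sup>2 + (Re z - Re w)\<^sup>2)" for z w
    define U where "U = (\<lambda>(z, w). (norm (F z))\<^sup>2 * \<kappa> z w)"
    have \<kappa>: "0 \<le> \<kappa> z w" "\<kappa> z w \<le> 1 / s" "\<kappa> z w = \<kappa> w z" for z w
    proof -
      show "0 \<le> \<kappa> z w" "\<kappa> z w = \<kappa> w z"
        using s by (simp_all add: \<kappa>_def power2_commute)
      have "\<kappa> z w \<le> s / s\<^sup>2"
        unfolding \<kappa>_def using s by (intro divide_left_mono mult_pos_pos add_pos_nonneg) auto
      then show "\<kappa> z w \<le> 1 / s"
        using s by (simp add: power2_eq_square)
    qed
    have [measurable]: "(\<lambda>(z, w). \<kappa> z w) \<in> borel_measurable (\<nu> \<Otimes>\<^sub>M \<nu>)"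
      unfolding \<kappa>_def by measurable
    have [measurable]: "U \<in> borel_measurable (\<nu> \<Otimes>\<^sub>M \<nu>)"
      unfolding U_def by measurable
    have U_int: "integrable (\<nu> \<Otimes>\<^sub>M \<nu>) U"
    proof (rule \<nu>\<nu>'.integrable_const_bound)
      show "AE p in \<nu> \<Otimes>\<^sub>M \<nu>. norm (U p) \<le> B\<^sup>2 * (1 / s)"
      proof (intro AE_I2, clarify)
        fix z w assume "(z, w) \<in> space (\<nu> \<Otimes>\<^sub>M \<nu>)"
        then have "(norm (F z))\<^sup>2 * \<kappa> z w \<le> B\<^sup>2 * (1 / s)"
          using F_bd \<kappa> B0 by (intro mult_mono power_mono) (auto simp: space_pair_measure)
        then show "norm (U (z, w)) \<le> B\<^sup>2 * (1 / s)"
          using \<kappa> by (simp add: U_def abs_mult)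
      qed
    qed simp
    have U_swap_int: "integrable (\<nu> \<Otimes>\<^sub>M \<nu>) (\<lambda>(z, w). U (w, z))"
      using \<nu>\<nu>.integrable_product_swap[OF U_int] .
    have "complex_of_real (LINT t|lborel. Q t) = (LINT t|lborel. (LINT p|(\<nu> \<Otimes>\<^sub>M \<nu>). \<Phi> p t))"
      unfolding Q_eq[symmetric] by simp
    also have "\<dots> = (LINT p|(\<nu> \<Otimes>\<^sub>M \<nu>). (LINT t|lborel. \<Phi> p t))"
      by (rule PL.Fubini_integral[OF \<Phi>_int])
    finally have "(LINT t|lborel. Q t) \<le> norm (LINT p|(\<nu> \<Otimes>\<^sub>M \<nu>). (LINT t|lborel. \<Phi> p t))"
      by (metis abs_ge_self norm_of_real)
    also have "\<dots> \<le> (LINT p|(\<nu> \<Otimes>\<^sub>M \<nu>). (1 / pi) * (U p + (case p of (z, w) \<Rightarrow> U (w, z))))"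
    proof (rule Bochner_Integration.integral_norm_bound_integral)
      show "integrable (\<nu> \<Otimes>\<^sub>M \<nu>) (\<lambda>p. (LINT t|lborel. \<Phi> p t))"
        using PL.integrable_fst[OF \<Phi>_int] by simp
      show "integrable (\<nu> \<Otimes>\<^sub>M \<nu>) (\<lambda>p. (1 / pi) * (U p + (case p of (z, w) \<Rightarrow> U (w, z))))"
        using U_int U_swap_int by simp
      fix p assume "p \<in> space (\<nu> \<Otimes>\<^sub>M \<nu>)"
      then obtain z w where p: "p = (z, w)" and zw: "z \<in> space \<nu>" "w \<in> space \<nu>"
        by (auto simp: space_pair_measure)
      have "norm (LINT t|lborel. \<Phi> p t) = norm (F z) * norm (F w) *
          norm (LINT t|lborel. of_real (strip_weight s t) * laplace_kernel t (z - cnj w))"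
        by (simp add: p \<Phi>_def norm_mult)
      also have "\<dots> \<le> norm (F z) * norm (F w) * ((2 / pi) * \<kappa> z w)"
        unfolding \<kappa>_def using strip[OF zw(1)] strip[OF zw(2)] s by (intro mult_left_mono strip_kernel_bound) auto
      also have "\<dots> = (1 / pi) * \<kappa> z w * (2 * norm (F z) * norm (F w))"
        by simp
      also have "\<dots> \<le> (1 / pi) * \<kappa> z w * ((norm (F z))\<^sup>2 + (norm (F w))\<^sup>2)"
        using \<kappa> by (intro mult_left_mono sum_squares_bound) auto
      also have "\<dots> = (1 / pi) * (U p + (case p of (z, w) \<Rightarrow> U (w, z)))"
        by (simp add: U_def p \<kappa>(3)[of w z] algebra_simps)
      finally show "norm (LINT t|lborel. \<Phi> p t) \<le> (1 / pi) * (U p + (case p of (z, w) \<Rightarrow> U (w, z)))" .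
    qed
    also have "\<dots> = (1 / pi) * ((LINT p|(\<nu> \<Otimes>\<^sub>M \<nu>). U p) + (LINT (z, w)|(\<nu> \<Otimes>\<^sub>M \<nu>). U (w, z)))"
      using U_int U_swap_int by simp
    also have "(LINT (z, w)|(\<nu> \<Otimes>\<^sub>M \<nu>). U (w, z)) = (LINT p|(\<nu> \<Otimes>\<^sub>M \<nu>). U p)"
      by (rule \<nu>\<nu>.integral_product_swap) simp
    also have "(LINT p|(\<nu> \<Otimes>\<^sub>M \<nu>). U p) = (LINT z|\<nu>. (LINT w|\<nu>. U (z, w)))"
      using U_int by (rule \<nu>\<nu>.integral_fst'[symmetric])
    also have "(1 / pi) * ((LINT z|\<nu>. (LINT w|\<nu>. U (z, w))) + (LINT z|\<nu>. (LINT w|\<nu>. U (z, w))))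
        \<le> (2 / pi) * (LINT z|\<nu>. (norm (F z))\<^sup>2 * M)"
    proof -
      have "(LINT z|\<nu>. (LINT w|\<nu>. U (z, w))) \<le> (LINT z|\<nu>. (norm (F z))\<^sup>2 * M)"
      proof (rule integral_mono)
        show "integrable \<nu> (\<lambda>z. (LINT w|\<nu>. U (z, w)))"
          using \<nu>\<nu>.integrable_fst'[OF U_int] .
        show "(LINT w|\<nu>. U (z, w)) \<le> (norm (F z))\<^sup>2 * M" if "z \<in> space \<nu>" for z
          using M(2)[OF that] unfolding U_def \<kappa>_def prod.case integral_mult_right_zero
          by (rule mult_left_mono) simp
      qed (use F2_int in simp)
      then show ?thesis by (simp add: divide_right_mono)
    qed
    also have "\<dots> = \<Lambda> * J"
      by (simp add: \<Lambda>_def J_def)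
    finally show ?thesis .
  qed
  have "J = norm (LINT t|lborel. h t * G t)"
    unfolding J_eq[symmetric] by (simp add: J_def)
  also have "\<dots> \<le> (LINT t|lborel. \<Lambda> / 2 * ((norm (h t))\<^sup>2 * exp (- 2 * pi * s * t)) + 1 / (2 * \<Lambda>) * Q t)"
  proof -
    have pt: "norm (h t * G t) \<le> \<Lambda> / 2 * ((norm (h t))\<^sup>2 * exp (- 2 * pi * s * t)) + 1 / (2 * \<Lambda>) * Q t" for t
    proof (cases "t > 0")
      case True
      \<comment> \<open>\<open>e\<close> is the weight at \<open>t > 0\<close>, and
        \<open>1 / e\<close> is the exponential in the integral of \<open>h\<close>. The inequality
        \<open>2 * x * y \<le> x\<^sup>2 + y\<^sup>2\<close> is taken at
        \<open>\<Lambda> * norm (h t)\<close> and \<open>e * norm (G t)\<close> and divided by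
        \<open>2 * \<Lambda> * e\<close>.\<close>
      define e where "e = exp (2 * pi * s * t)"
      have e: "e > 0" "exp (- 2 * pi * s * t) = 1 / e" "Q t = e * (norm (G t))\<^sup>2"
        using True by (simp_all add: e_def exp_minus field_simps Q_def strip_weight_def)
      have "2 * (\<Lambda> * norm (h t)) * (e * norm (G t)) \<le> (\<Lambda> * norm (h t))\<^sup>2 + (e * norm (G t))\<^sup>2"
        by (rule sum_squares_bound)
      then have "2 * (\<Lambda> * norm (h t)) * (e * norm (G t)) / (2 * \<Lambda> * e) \<le> ((\<Lambda> * norm (h t))\<^sup>2 + (e * norm (G t))\<^sup>2) / (2 * \<Lambda> * e)"
        using \<Lambda> e by (intro divide_right_mono) auto
      then show ?thesis
        using \<Lambda> e by (simp add: norm_mult add_divide_distrib power_mult_distrib power2_eq_square mult.left_commute)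
    qed (use \<Lambda> sw0 in \<open>auto simp: h0 Q_def\<close>)
    have int: "integrable lborel (\<lambda>t. \<Lambda> / 2 * ((norm (h t))\<^sup>2 * exp (- 2 * pi * s * t)) + 1 / (2 * \<Lambda>) * Q t)"
      using h2 Q_int by simp
    have "(\<lambda>(t, z). cnj (F z) * laplace_kernel t z) \<in> borel_measurable (borel \<Otimes>\<^sub>M \<nu>)"
      by measurable
    then have [measurable]: "G \<in> borel_measurable borel"
      unfolding G_def by (rule \<nu>.borel_measurable_lebesgue_integral)
    have "integrable lborel (\<lambda>t. h t * G t)"
      by (rule Bochner_Integration.integrable_bound[OF int])
         (use pt in \<open>auto intro!: AE_I2 order_trans[OF _ abs_ge_self]\<close>)
    then show ?thesis
      using int pt by (rule Bochner_Integration.integral_norm_bound_integral)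
  qed
  also have "\<dots> = \<Lambda> / 2 * (LINT t|lborel. (norm (h t))\<^sup>2 * exp (- 2 * pi * s * t)) + 1 / (2 * \<Lambda>) * (LINT t|lborel. Q t)"
    using h2 Q_int by simp
  also have "1 / (2 * \<Lambda>) * (LINT t|lborel. Q t) \<le> 1 / (2 * \<Lambda>) * (\<Lambda> * J)"
    using Q_le \<Lambda> by (intro mult_left_mono) auto
  also have "1 / (2 * \<Lambda>) * (\<Lambda> * J) = J / 2" using \<Lambda> by simp
  finally show ?thesis by (simp add: J_def \<Lambda>_def)
qed

section \<open>Carleson measures\<close>

text \<open>The exponent \<open>a\<close> stands for \<open>q / conjugate_exponent p\<close>. The
  strip estimates hold for every real \<open>a\<close>; only \<open>laplace_embedding\<close> ties
  it to \<open>p\<close> and \<open>q\<close>.\<close>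

locale carleson_measure =
  fixes \<mu> :: "complex measure" and a C0 :: real
  assumes sets_\<mu>: "sets \<mu> = sets (restrict_space borel upper_half_plane)"
    and C0: "0 < C0"
    and carleson: "\<And>I. is_interval I \<Longrightarrow> bounded I \<Longrightarrow>
          emeasure \<mu> (carleson_box I) \<le> ennreal (C0 * measure lborel I powr a)"
begin

lemma space_\<mu>: "space \<mu> = upper_half_plane"
  using sets_eq_imp_space_eq[OF sets_\<mu>] by (simp add: space_restrict_space)

lemma in_sets_\<mu>: "A \<in> sets borel \<Longrightarrow> A \<subseteq> upper_half_plane \<Longrightarrow> A \<in> sets \<mu>"
  unfolding sets_\<mu> by (auto simp: sets_restrict_space image_iff)

lemma measurable_\<mu> [measurable]: "(\<lambda>z. z) \<in> \<mu> \<rightarrow>\<^sub>M borel"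
  by (subst measurable_cong_sets[OF sets_\<mu> refl]) (rule measurable_restrict_space1, simp)

lemma measurable_\<mu>_borel: "f \<in> borel_measurable borel \<Longrightarrow> f \<in> borel_measurable \<mu>"
  using measurable_compose[OF measurable_\<mu>] by blast

lemma measurable_Re_Im [measurable]: "Re \<in> borel_measurable \<mu>" "Im \<in> borel_measurable \<mu>"
  by (simp_all add: measurable_\<mu>_borel)

lemma box_in_sets: "is_interval I \<Longrightarrow> carleson_box I \<in> sets \<mu>"
proof (rule in_sets_\<mu>)
  assume "is_interval I"
  then have I [measurable]: "I \<in> sets borel" by (rule real_interval_borel_measurable)
  show "carleson_box I \<in> sets borel"
    unfolding carleson_box_def by measurable
qed (auto simp: carleson_box_def upper_half_plane_def)

text \<open>One octave of heights, with a continuous parameter, so that decomposing the half-plane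
  means integrating against \<open>ds / s\<close>.\<close>

definition strip :: "real \<Rightarrow> complex set"
  where "strip s = {z. s < Im z \<and> Im z \<le> 2 * s}"

lemma strip_in_sets [measurable]: "0 < s \<Longrightarrow> strip s \<in> sets \<mu>"
proof (rule in_sets_\<mu>)
  have "strip s = {z \<in> space borel. s < Im z \<and> Im z \<le> 2 * s}" by (auto simp: strip_def)
  also have "\<dots> \<in> sets borel" by measurable
  finally show "strip s \<in> sets borel" .
qed (auto simp: strip_def upper_half_plane_def)

text \<open>The strip is cut into pieces \<open>D n\<close> on which the horizontal distance from
  \<open>x\<close> is between \<open>2 * s * n\<close> and \<open>2 * s * (n + 1)\<close>. Each
  piece is covered by two Carleson boxes over intervals of length \<open>2 * s\<close>, just high
  enough to contain the strip, so its measure is bounded independently of \<open>n\<close>. The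
  kernel on \<open>D n\<close> is at most \<open>1 / s\<close> times the summable
  \<open>1 / (1 + n\<^sup>2)\<close>.\<close>

lemma strip_kernel_integral_bound:
  obtains C where "C > 0"
    "\<And>s x. 0 < s \<Longrightarrow> (\<integral>\<^sup>+w. ennreal (s / (s\<^sup>2 + (x - Re w)\<^sup>2)) * indicator (strip s) w \<partial>\<mu>) \<le> ennreal (C * s powr (a - 1))"
proof
  have summ: "summable (\<lambda>n. 1 / (1 + (real n)\<^sup>2))"
  proof (rule summable_comparison_test_ev)
    show "summable (\<lambda>n. 1 / (real n)\<^sup>2)"
      using inverse_power_summable[of 2, where 'a=real] by (simp add: field_simps)
    show "\<forall>\<^sub>F n in sequentially. norm (1 / (1 + (real n)\<^sup>2)) \<le> 1 / (real n)\<^sup>2"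
      using eventually_gt_at_top[of 0] by eventually_elim (auto intro!: divide_left_mono simp: add_pos_nonneg)
  qed
  define S where "S = (\<Sum>n. 1 / (1 + (real n)\<^sup>2))"
  have S: "S > 0" unfolding S_def by (rule suminf_pos[OF summ]) (auto simp: add_pos_nonneg)
  show "0 < 2 * C0 * 2 powr a * S" using C0 S by simp
  fix s x :: real assume s: "0 < s"
  define D where "D n = {w \<in> space \<mu>. w \<in> strip s \<and> 2 * s * real n \<le> \<bar>x - Re w\<bar> \<and> \<bar>x - Re w\<bar> < 2 * s * (real n + 1)}" for n :: nat
  have D_sets [measurable]: "D n \<in> sets \<mu>" for n
    unfolding D_def using s by measurable
  have D_bd: "emeasure \<mu> (D n) \<le> ennreal (2 * C0 * (2 * s) powr a)" for n
  proof -
    define I1 where "I1 = {x + 2 * s * real n .. x + 2 * s * (real n + 1)}"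
    define I2 where "I2 = {x - 2 * s * (real n + 1) .. x - 2 * s * real n}"
    have len: "measure lborel I1 = 2 * s" "measure lborel I2 = 2 * s"
      using s by (simp_all add: I1_def I2_def algebra_simps)
    have I: "is_interval I1" "bounded I1" "is_interval I2" "bounded I2"
      by (simp_all add: I1_def I2_def is_interval_cc)
    have "D n \<subseteq> carleson_box I1 \<union> carleson_box I2"
      using s len unfolding D_def carleson_box_def strip_def
      by (auto simp: I1_def I2_def abs_if algebra_simps split: if_splits)
    then have "emeasure \<mu> (D n) \<le> emeasure \<mu> (carleson_box I1 \<union> carleson_box I2)"
      using I box_in_sets by (intro emeasure_mono) auto
    also have "\<dots> \<le> emeasure \<mu> (carleson_box I1) + emeasure \<mu> (carleson_box I2)"
      using I box_in_sets by (intro emeasure_subadditive) auto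
    also have "\<dots> \<le> ennreal (C0 * (2 * s) powr a) + ennreal (C0 * (2 * s) powr a)"
      using carleson[OF I(1,2)] carleson[OF I(3,4)] len by (intro add_mono) auto
    also have "\<dots> = ennreal (2 * C0 * (2 * s) powr a)"
      using C0 by (subst ennreal_plus[symmetric]) auto
    finally show ?thesis .
  qed
  have "(\<integral>\<^sup>+w. ennreal (s / (s\<^sup>2 + (x - Re w)\<^sup>2)) * indicator (strip s) w \<partial>\<mu>)
      \<le> (\<integral>\<^sup>+w. (\<Sum>n. ennreal (1 / s * (1 / (1 + (real n)\<^sup>2))) * indicator (D n) w) \<partial>\<mu>)"
  proof (rule nn_integral_mono)
    fix w assume w: "w \<in> space \<mu>"
    show "ennreal (s / (s\<^sup>2 + (x - Re w)\<^sup>2)) * indicator (strip s) w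
        \<le> (\<Sum>n. ennreal (1 / s * (1 / (1 + (real n)\<^sup>2))) * indicator (D n) w)"
    proof (cases "w \<in> strip s")
      case True
      define n where "n = nat \<lfloor>\<bar>x - Re w\<bar> / (2 * s)\<rfloor>"
      have n: "real n \<le> \<bar>x - Re w\<bar> / (2 * s)" "\<bar>x - Re w\<bar> / (2 * s) < real n + 1"
        using s unfolding n_def by (auto simp: of_nat_nat)
      then have n': "2 * s * real n \<le> \<bar>x - Re w\<bar>" "\<bar>x - Re w\<bar> < 2 * s * (real n + 1)"
        using s by (simp_all add: field_simps)
      then have wD: "w \<in> D n" using w True by (simp add: D_def)
      \<comment> \<open>Weakening \<open>2 * s * real n\<close> to \<open>s * real n\<close> lets
        \<open>s\<^sup>2\<close> be factored out of the denominator.\<close>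
      have "(s * real n)\<^sup>2 \<le> \<bar>x - Re w\<bar>\<^sup>2"
        using n'(1) s by (intro power_mono) (auto intro: order_trans[rotated])
      then have le: "s\<^sup>2 * (1 + (real n)\<^sup>2) \<le> s\<^sup>2 + (x - Re w)\<^sup>2"
        by (simp add: power_mult_distrib algebra_simps)
      have "s / (s\<^sup>2 + (x - Re w)\<^sup>2) \<le> s / (s\<^sup>2 * (1 + (real n)\<^sup>2))"
        using s le by (intro divide_left_mono mult_pos_pos) (auto simp: add_pos_nonneg)
      also have "\<dots> = 1 / s * (1 / (1 + (real n)\<^sup>2))"
        using s by (simp add: power2_eq_square)
      finally have "ennreal (s / (s\<^sup>2 + (x - Re w)\<^sup>2)) * indicator (strip s) w
          \<le> ennreal (1 / s * (1 / (1 + (real n)\<^sup>2))) * indicator (D n) w"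
        using True wD by (simp add: ennreal_leI)
      also have "\<dots> \<le> (\<Sum>n. ennreal (1 / s * (1 / (1 + (real n)\<^sup>2))) * indicator (D n) w)"
        using sum_le_suminf[of "\<lambda>n. ennreal (1 / s * (1 / (1 + (real n)\<^sup>2))) * indicator (D n) w" "{n}"]
        by (simp del: indicator_eq_0_iff sum_mult_indicator sum.insert_if add: sum.insert)
      finally show ?thesis .
    qed simp
  qed
  also have "\<dots> = (\<Sum>n. \<integral>\<^sup>+w. ennreal (1 / s * (1 / (1 + (real n)\<^sup>2))) * indicator (D n) w \<partial>\<mu>)"
    by (rule nn_integral_suminf) measurable
  also have "\<dots> = (\<Sum>n. ennreal (1 / s * (1 / (1 + (real n)\<^sup>2))) * emeasure \<mu> (D n))"
    by (simp add: nn_integral_cmult_indicator)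
  also have "\<dots> \<le> (\<Sum>n. ennreal (1 / s * (1 / (1 + (real n)\<^sup>2))) * ennreal (2 * C0 * (2 * s) powr a))"
    using D_bd by (intro suminf_le mult_left_mono) auto
  also have "\<dots> = (\<Sum>n. ennreal ((2 * C0 * (2 * s) powr a / s) * (1 / (1 + (real n)\<^sup>2))))"
    using s C0 by (simp add: ennreal_mult[symmetric] mult.commute)
  also have "\<dots> = ennreal (\<Sum>n. (2 * C0 * (2 * s) powr a / s) * (1 / (1 + (real n)\<^sup>2)))"
    using s C0 summ by (intro suminf_ennreal2 summable_mult) auto
  also have "(\<Sum>n. (2 * C0 * (2 * s) powr a / s) * (1 / (1 + (real n)\<^sup>2))) = 2 * C0 * (2 * s) powr a / s * S"
    unfolding S_def by (rule suminf_mult[OF summ])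
  also have "\<dots> = 2 * C0 * 2 powr a * S * s powr (a - 1)"
    using s by (simp add: powr_mult powr_diff)
  finally show "(\<integral>\<^sup>+w. ennreal (s / (s\<^sup>2 + (x - Re w)\<^sup>2)) * indicator (strip s) w \<partial>\<mu>)
      \<le> ennreal (2 * C0 * 2 powr a * S * s powr (a - 1))" .
qed

text \<open>The whole strip may have infinite measure, so the bound for finite measures is applied
  to the truncations \<open>S N\<close> to bounded real part. Their Schur constants are dominated by
  that of the full strip, uniformly in \<open>N\<close>, and monotone convergence concludes.\<close>

lemma strip_L2_bound:
  obtains C where "C > 0"
    "\<And>h s. h \<in> borel_measurable borel \<Longrightarrow> (\<And>t. t \<le> 0 \<Longrightarrow> h t = 0) \<Longrightarrow> 0 < s \<Longrightarrow>
       integrable lborel (\<lambda>t. norm (h t) * exp (- 2 * pi * s * t)) \<Longrightarrow>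
       integrable lborel (\<lambda>t. (norm (h t))\<^sup>2 * exp (- 2 * pi * s * t)) \<Longrightarrow>
       (\<integral>\<^sup>+z. ennreal ((norm (LINT t|lborel. h t * laplace_kernel t z))\<^sup>2) * indicator (strip s) z \<partial>\<mu>)
         \<le> ennreal (C * s powr (a - 1) * (LINT t|lborel. (norm (h t))\<^sup>2 * exp (- 2 * pi * s * t)))"
proof -
  obtain C where C: "C > 0" and kernel: "\<And>s x. 0 < s \<Longrightarrow>
      (\<integral>\<^sup>+w. ennreal (s / (s\<^sup>2 + (x - Re w)\<^sup>2)) * indicator (strip s) w \<partial>\<mu>) \<le> ennreal (C * s powr (a - 1))"
    using strip_kernel_integral_bound by blast
  show thesis
  proof
    show "2 / pi * C > 0" using C by simp
    fix h :: "real \<Rightarrow> complex" and s :: real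
    assume h_meas [measurable]: "h \<in> borel_measurable borel" and h0: "\<And>t. t \<le> 0 \<Longrightarrow> h t = 0" and s: "0 < s"
      and h1: "integrable lborel (\<lambda>t. norm (h t) * exp (- 2 * pi * s * t))"
      and h2: "integrable lborel (\<lambda>t. (norm (h t))\<^sup>2 * exp (- 2 * pi * s * t))"
    define F where "F z = (LINT t|lborel. h t * laplace_kernel t z)" for z
    define R where "R = 2 / pi * C * s powr (a - 1) * (LINT t|lborel. (norm (h t))\<^sup>2 * exp (- 2 * pi * s * t))"
    define S where "S N = strip s \<inter> {z \<in> space \<mu>. \<bar>Re z\<bar> \<le> real N}" for N :: nat
    have F_meas [measurable]: "F \<in> borel_measurable \<mu>"
      unfolding F_def by (intro measurable_\<mu>_borel) measurable
    have S_sets [measurable]: "S N \<in> sets \<mu>" for N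
      unfolding S_def using s by measurable
    have S_fin: "emeasure \<mu> (S N) < \<infinity>" for N
    proof -
      \<comment> \<open>The summand \<open>2 * s\<close> makes the box reach the top of the strip
        even for \<open>N = 0\<close>.\<close>
      define L where "L = real N + 2 * s"
      have "S N \<subseteq> carleson_box {- L .. L}"
        using s by (auto simp: S_def strip_def carleson_box_def L_def)
      then have "emeasure \<mu> (S N) \<le> emeasure \<mu> (carleson_box {- L .. L})"
        by (intro emeasure_mono box_in_sets is_interval_cc)
      also have "\<dots> \<le> ennreal (C0 * measure lborel {- L .. L} powr a)"
        by (intro carleson is_interval_cc) simp
      also have "\<dots> < \<infinity>" by simp
      finally show ?thesis .
    qed
    have piece: "(\<integral>\<^sup>+z. ennreal ((norm (F z))\<^sup>2) * indicator (S N) z \<partial>\<mu>) \<le> ennreal R" for N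
    proof -
      define \<nu> where "\<nu> = restrict_space \<mu> (S N)"
      have space_\<nu>: "space \<nu> = S N"
        using sets.sets_into_space[OF S_sets[of N]] by (auto simp: \<nu>_def space_restrict_space)
      have fin: "finite_measure \<nu>"
        using S_fin[of N] by (intro finite_measureI) (simp add: space_\<nu>, simp add: \<nu>_def emeasure_restrict_space)
      interpret finite_measure \<nu> by (rule fin)
      have id: "(\<lambda>z. z) \<in> \<nu> \<rightarrow>\<^sub>M borel"
        unfolding \<nu>_def by (rule measurable_restrict_space1) (rule measurable_\<mu>)
      have Re_meas [measurable]: "Re \<in> borel_measurable \<nu>" and F_meas' [measurable]: "F \<in> borel_measurable \<nu>"
        unfolding \<nu>_def by (auto intro!: measurable_restrict_space1)
      have M: "(LINT w|\<nu>. s / (s\<^sup>2 + (Re z - Re w)\<^sup>2)) \<le> C * s powr (a - 1)" for z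
      proof -
        have "ennreal (LINT w|\<nu>. s / (s\<^sup>2 + (Re z - Re w)\<^sup>2)) = (\<integral>\<^sup>+w. ennreal (s / (s\<^sup>2 + (Re z - Re w)\<^sup>2)) \<partial>\<nu>)"
        proof (rule nn_integral_eq_integral[symmetric])
          show "integrable \<nu> (\<lambda>w. s / (s\<^sup>2 + (Re z - Re w)\<^sup>2))"
          proof (rule integrable_const_bound)
            show "AE w in \<nu>. norm (s / (s\<^sup>2 + (Re z - Re w)\<^sup>2)) \<le> s / s\<^sup>2"
              using s by (auto intro!: divide_left_mono mult_pos_pos add_pos_nonneg)
          qed measurable
        qed (use s in auto)
        also have "\<dots> = (\<integral>\<^sup>+w. ennreal (s / (s\<^sup>2 + (Re z - Re w)\<^sup>2)) * indicator (S N) w \<partial>\<mu>)"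
          unfolding \<nu>_def by (rule nn_integral_restrict_space) simp
        also have "\<dots> \<le> (\<integral>\<^sup>+w. ennreal (s / (s\<^sup>2 + (Re z - Re w)\<^sup>2)) * indicator (strip s) w \<partial>\<mu>)"
          by (intro nn_integral_mono mult_left_mono) (auto simp: S_def indicator_def)
        also have "\<dots> \<le> ennreal (C * s powr (a - 1))"
          by (rule kernel[OF s])
        finally show ?thesis using C by (simp add: ennreal_le_iff)
      qed
      have bound: "(LINT z|\<nu>. (norm (F z))\<^sup>2) \<le> R"
        using laplace_L2_strip_bound[OF fin id s _ h_meas h0 h1 h2 _ M] C s
        unfolding F_def[symmetric] R_def space_\<nu> by (auto simp: S_def strip_def mult.assoc)
      define B where "B = (LINT t|lborel. norm (h t) * exp (- 2 * pi * s * t))"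
      have "(\<integral>\<^sup>+z. ennreal ((norm (F z))\<^sup>2) * indicator (S N) z \<partial>\<mu>) = (\<integral>\<^sup>+z. ennreal ((norm (F z))\<^sup>2) \<partial>\<nu>)"
        unfolding \<nu>_def by (rule nn_integral_restrict_space[symmetric]) simp
      also have "\<dots> = ennreal (LINT z|\<nu>. (norm (F z))\<^sup>2)"
      proof (rule nn_integral_eq_integral)
        show "integrable \<nu> (\<lambda>z. (norm (F z))\<^sup>2)"
        proof (rule integrable_const_bound)
          show "AE z in \<nu>. norm ((norm (F z))\<^sup>2) \<le> B\<^sup>2"
          proof (rule AE_I2)
            fix z assume "z \<in> space \<nu>"
            then have "norm (F z) \<le> B"
              unfolding F_def B_def space_\<nu> by (intro norm_laplace_le h0 h1) (auto simp: S_def strip_def)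
            then show "norm ((norm (F z))\<^sup>2) \<le> B\<^sup>2" by (simp add: power_mono)
          qed
        qed measurable
      qed simp
      also have "\<dots> \<le> ennreal R" using bound by (rule ennreal_leI)
      finally show ?thesis .
    qed
    have "(\<integral>\<^sup>+z. ennreal ((norm (F z))\<^sup>2) * indicator (strip s) z \<partial>\<mu>)
        = (\<integral>\<^sup>+z. (SUP N. ennreal ((norm (F z))\<^sup>2) * indicator (S N) z) \<partial>\<mu>)"
    proof (rule nn_integral_cong)
      fix z assume z: "z \<in> space \<mu>"
      show "ennreal ((norm (F z))\<^sup>2) * indicator (strip s) z = (SUP N. ennreal ((norm (F z))\<^sup>2) * indicator (S N) z)"
      proof (rule antisym)
        obtain N where "\<bar>Re z\<bar> \<le> real N" using real_arch_simple by blast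
        then have "indicator (strip s) z = (indicator (S N) z :: ennreal)"
          using z by (simp add: S_def indicator_def)
        then show "ennreal ((norm (F z))\<^sup>2) * indicator (strip s) z \<le> (SUP N. ennreal ((norm (F z))\<^sup>2) * indicator (S N) z)"
          by (simp only:) (rule SUP_upper, simp)
        show "(SUP N. ennreal ((norm (F z))\<^sup>2) * indicator (S N) z) \<le> ennreal ((norm (F z))\<^sup>2) * indicator (strip s) z"
          by (intro SUP_least mult_left_mono) (auto simp: S_def indicator_def)
      qed
    qed
    also have "\<dots> = (SUP N. \<integral>\<^sup>+z. ennreal ((norm (F z))\<^sup>2) * indicator (S N) z \<partial>\<mu>)"
    proof (rule nn_integral_monotone_convergence_SUP)
      show "incseq (\<lambda>N z. ennreal ((norm (F z))\<^sup>2) * indicator (S N) z)"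
        by (auto simp: incseq_def le_fun_def S_def indicator_def intro!: mult_left_mono)
    qed measurable
    also have "\<dots> \<le> ennreal R" using piece by (rule SUP_least)
    finally show "(\<integral>\<^sup>+z. ennreal ((norm (LINT t|lborel. h t * laplace_kernel t z))\<^sup>2) * indicator (strip s) z \<partial>\<mu>)
         \<le> ennreal (2 / pi * C * s powr (a - 1) * (LINT t|lborel. (norm (h t))\<^sup>2 * exp (- 2 * pi * s * t)))"
      unfolding F_def R_def .
  qed
qed

end

section \<open>Elementary inequalities for the integrals \<open>A s\<close> and
  \<open>B s\<close>\<close>

text \<open>Hoelder's inequality against the exponential, whose norm is
  \<open>(2 * pi * s * r') powr (- 1 / r')\<close>; the factor \<open>2 * pi * r'\<close> exceeds 1
  and is dropped. It is applied with exponent \<open>p\<close> to the modulus of the function and,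
  for integrability only, with \<open>p / 2\<close> to its square.\<close>

lemma Lp_times_exp:
  fixes g :: "real \<Rightarrow> real"
  assumes r: "1 < r" and s: "0 < s"
    and [measurable]: "g \<in> borel_measurable borel" and g: "\<And>t. 0 \<le> g t" "\<And>t. t \<le> 0 \<Longrightarrow> g t = 0"
    and int: "integrable lborel (\<lambda>t. g t powr r)"
  shows "integrable lborel (\<lambda>t. g t * exp (- 2 * pi * s * t))"
    and "(LINT t|lborel. g t * exp (- 2 * pi * s * t)) \<le> (LINT t|lborel. g t powr r) powr (1 / r) * s powr (- ((r - 1) / r))"
proof -
  define r' where "r' = r / (r - 1)"
  have r': "r' > 1" and conj: "1 / r + 1 / r' = 1"
    using r by (auto simp: r'_def field_simps)
  define v where "v t = indicator {0<..} t * exp (- 2 * pi * s * t)" for t :: real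
  have [measurable]: "v \<in> borel_measurable borel" by (simp add: v_def[abs_def])
  have v_powr: "v t powr r' = indicator {0<..} t * (t powr (1 - 1) * exp (- (2 * pi * s * r') * t))" for t
    using r' by (auto simp: v_def exp_powr_real indicator_def mult_ac)
  have hv: "has_bochner_integral lborel (\<lambda>t. v t powr r') (1 / (2 * pi * s * r'))"
    unfolding v_powr using has_bochner_integral_Gamma_scaled[of 1 "2 * pi * s * r'"] s r' by (simp add: powr_minus_divide)
  have gv: "g t * exp (- 2 * pi * s * t) = g t * v t" for t
    using g(2)[of t] by (auto simp: v_def indicator_def)
  have "integrable lborel (\<lambda>t. v t powr r')" using hv by (simp add: has_bochner_integral_iff)
  note H = Holder_inequality_integral[OF r r' conj _ _ g(1) _ int this]
  show "integrable lborel (\<lambda>t. g t * exp (- 2 * pi * s * t))"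
    unfolding gv by (rule H(1)) (auto simp: v_def)
  have "(LINT t|lborel. g t * exp (- 2 * pi * s * t))
      \<le> (LINT t|lborel. g t powr r) powr (1 / r) * (LINT t|lborel. v t powr r') powr (1 / r')"
    unfolding gv by (rule H(2)) (auto simp: v_def)
  also have "(LINT t|lborel. v t powr r') = 1 / (2 * pi * s * r')"
    using hv by (simp add: has_bochner_integral_iff)
  also have "\<dots> powr (1 / r') \<le> (1 / s) powr (1 / r')"
  proof (rule powr_mono2)
    have "1 * (s * 1) \<le> 2 * pi * (s * r')"
      using s r' pi_ge_two by (intro mult_mono) auto
    then show "1 / (2 * pi * s * r') \<le> 1 / s"
      using s r' by (intro divide_left_mono mult_pos_pos) (auto simp: mult_ac)
  qed (use s r' in auto)
  also have "(1 / s) powr (1 / r') = s powr (- ((r - 1) / r))"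
    using s by (simp add: r'_def powr_divide powr_minus_divide)
  finally show "(LINT t|lborel. g t * exp (- 2 * pi * s * t)) \<le> (LINT t|lborel. g t powr r) powr (1 / r) * s powr (- ((r - 1) / r))"
    by (simp add: mult_left_mono)
qed

text \<open>Young's inequality with the exponents \<open>p / (p - 2)\<close> and
  \<open>p / 2\<close>, conjugate because \<open>p > 2\<close>. The power of \<open>s\<close> is
  distributed between \<open>x\<close> and \<open>y\<close> so that the two terms carry the weights
  of \<open>real_laplace_weighted_bound\<close> for \<open>r = p\<close> and
  \<open>r = p / 2\<close>. The common factor \<open>s\<close> cancels the \<open>1 / s\<close> of
  the decomposition into strips.\<close>

lemma Young_splitting:
  fixes A B s p :: real
  assumes p: "2 < p" and pos: "0 \<le> A" "0 \<le> B" "0 < s"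
  shows "s powr (p - 2) * B powr (p - 2) * A \<le> s * (B powr p * s powr (p - 2) + A powr (p / 2) * s powr (p / 2 - 2))"
proof -
  define P where "P = p / (p - 2)"
  define x where "x = B powr (p - 2) * s powr ((p - 1) * (p - 2) / p)"
  define y where "y = A * s powr ((p - 2) / p)"
  have P: "1 < P" "1 < p / 2" "1 / P + 1 / (p / 2) = 1"
    using p by (auto simp: P_def field_simps)
  have "s powr (p - 2) * B powr (p - 2) * A = x * y"
  proof -
    have "(p - 1) * (p - 2) / p + (p - 2) / p = p - 2" using p by (simp add: field_simps)
    then have "s powr ((p - 1) * (p - 2) / p) * s powr ((p - 2) / p) = s powr (p - 2)"
      by (simp flip: powr_add)
    then show ?thesis by (simp add: x_def y_def ac_simps)
  qed
  also have "\<dots> \<le> x powr P / P + y powr (p / 2) / (p / 2)"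
    by (rule Youngs_inequality[OF P]) (use pos in \<open>auto simp: x_def y_def\<close>)
  also have "\<dots> \<le> x powr P / 1 + y powr (p / 2) / 1"
    using P by (intro add_mono divide_left_mono) auto
  also have "x powr P = B powr p * s powr (p - 1)"
    using p by (simp add: x_def P_def powr_mult powr_powr)
  also have "y powr (p / 2) = A powr (p / 2) * s powr (p / 2 - 1)"
  proof -
    have "(p - 2) / p * (p / 2) = p / 2 - 1" using p by (simp add: field_simps)
    then show ?thesis by (simp only: y_def powr_mult powr_powr)
  qed
  also have "B powr p * s powr (p - 1) / 1 + A powr (p / 2) * s powr (p / 2 - 1) / 1
      = s * (B powr p * s powr (p - 2) + A powr (p / 2) * s powr (p / 2 - 2))"
  proof -
    have *: "s * s powr (p - 2) = s powr (p - 1)" "s * s powr (p / 2 - 2) = s powr (p / 2 - 1)"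
      using pos by (simp_all add: powr_mult_base)
    show ?thesis by (simp add: *[symmetric] distrib_left mult.left_commute)
  qed
  finally show ?thesis .
qed

section \<open>Integration over strips and the embedding for Borel functions\<close>

context carleson_measure
begin

text \<open>Needed to exchange the integrals over \<open>s\<close> and \<open>\<mu>\<close>. The
  boxes over \<open>{- n .. n}\<close> have height \<open>2 * n\<close>, exhaust the half-plane and
  have finite measure by the Carleson condition.\<close>

lemma sigma_finite_\<mu>: "sigma_finite_measure \<mu>"
proof
  define U where "U = range (\<lambda>n :: nat. carleson_box {- real n .. real n})"
  show "\<exists>A. countable A \<and> A \<subseteq> sets \<mu> \<and> \<Union> A = space \<mu> \<and> (\<forall>a\<in>A. emeasure \<mu> a \<noteq> \<infinity>)"
  proof (intro exI[of _ U] conjI ballI)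
    show "countable U" by (simp add: U_def)
    show sets_U: "U \<subseteq> sets \<mu>"
      unfolding U_def by (intro image_subsetI box_in_sets is_interval_cc)
    show "\<Union>U = space \<mu>"
    proof (rule equalityI)
      show "\<Union>U \<subseteq> space \<mu>"
        using sets_U sets.sets_into_space by (intro Union_least) blast
      show "space \<mu> \<subseteq> \<Union>U"
      proof
        fix z assume "z \<in> space \<mu>"
        then have z: "Im z > 0" by (simp add: space_\<mu> upper_half_plane_def)
        obtain n where n: "\<bar>Re z\<bar> + Im z \<le> real n" using real_arch_simple by blast
        then have "- real n \<le> Re z" "Re z \<le> real n" "Im z \<le> 2 * real n" using z by linarith+
        then have "z \<in> carleson_box {- real n .. real n}"
          using z by (simp add: carleson_box_def)
        then show "z \<in> \<Union>U" unfolding U_def by (rule UnionI[OF rangeI])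
      qed
    qed
    fix b assume "b \<in> U"
    then obtain n where b: "b = carleson_box {- real n .. real n}" by (auto simp: U_def)
    have "emeasure \<mu> b \<le> ennreal (C0 * measure lborel {- real n .. real n} powr a)"
      unfolding b by (intro carleson is_interval_cc bounded_closed_interval)
    also have "\<dots> < top" by (rule ennreal_less_top)
    finally show "emeasure \<mu> b \<noteq> \<infinity>" by simp
  qed
qed

text \<open>A point at height \<open>y\<close> lies in \<open>strip s\<close> exactly for
  \<open>y / 2 \<le> s < y\<close>. The measure \<open>ds / s\<close> of this interval is the
  logarithm of 2; the cruder bound \<open>1 / s \<ge> 1 / y\<close> gives at least
  \<open>1 / 2\<close>, whence the factor 2.\<close>

lemma nn_integral_le_strips:
  assumes [measurable]: "g \<in> borel_measurable \<mu>"
  shows "(\<integral>\<^sup>+z. g z \<partial>\<mu>) \<le> 2 * (\<integral>\<^sup>+s. ennreal (indicator {0<..} s / s) * (\<integral>\<^sup>+z. g z * indicator (strip s) z \<partial>\<mu>) \<partial>lborel)"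
proof -
  interpret sigma_finite_measure \<mu> by (rule sigma_finite_\<mu>)
  interpret P: pair_sigma_finite lborel \<mu> ..
  have [measurable]: "(\<lambda>(s, z). indicator (strip s) z :: ennreal) \<in> borel_measurable (lborel \<Otimes>\<^sub>M \<mu>)"
  proof -
    have "(\<lambda>(s, z). indicator (strip s) z :: ennreal) = (\<lambda>(s, z). if s < Im z \<and> Im z \<le> 2 * s then 1 else 0)"
      by (auto simp: strip_def indicator_def)
    also have "\<dots> \<in> borel_measurable (lborel \<Otimes>\<^sub>M \<mu>)" by measurable
    finally show ?thesis .
  qed
  have "(\<integral>\<^sup>+z. g z \<partial>\<mu>) \<le> (\<integral>\<^sup>+z. 2 * (\<integral>\<^sup>+s. ennreal (indicator {0<..} s / s) * (g z * indicator (strip s) z) \<partial>lborel) \<partial>\<mu>)"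
  proof (rule nn_integral_mono)
    fix z assume "z \<in> space \<mu>"
    then have y: "Im z > 0" by (simp add: space_\<mu> upper_half_plane_def)
    have "2 * (ennreal (1 / Im z) * emeasure lborel {Im z / 2 ..< Im z}) = 1"
    proof -
      have "ennreal 2 * (ennreal (1 / Im z) * ennreal (Im z - Im z / 2)) = ennreal (2 * (1 / Im z * (Im z - Im z / 2)))"
        using y by (simp only: ennreal_mult'' ennreal_mult' divide_nonneg_pos zero_le_one)
      also have "2 * (1 / Im z * (Im z - Im z / 2)) = 1" using y by (simp add: field_simps)
      finally show ?thesis using y by simp
    qed
    then have "g z = 2 * (ennreal (1 / Im z) * emeasure lborel {Im z / 2 ..< Im z}) * g z" by simp
    also have "\<dots> = 2 * ((\<integral>\<^sup>+s. ennreal (1 / Im z) * indicator {Im z / 2 ..< Im z} s \<partial>lborel) * g z)"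
      by (simp add: nn_integral_cmult_indicator mult.assoc)
    also have "\<dots> = 2 * (\<integral>\<^sup>+s. ennreal (1 / Im z) * indicator {Im z / 2 ..< Im z} s * g z \<partial>lborel)"
      by (subst nn_integral_multc) auto
    also have "\<dots> \<le> 2 * (\<integral>\<^sup>+s. ennreal (indicator {0<..} s / s) * (g z * indicator (strip s) z) \<partial>lborel)"
    proof (intro mult_left_mono nn_integral_mono)
      fix s :: real
      show "ennreal (1 / Im z) * indicator {Im z / 2 ..< Im z} s * g z \<le> ennreal (indicator {0<..} s / s) * (g z * indicator (strip s) z)"
      proof (cases "s \<in> {Im z / 2 ..< Im z}")
        case True
        then have "z \<in> strip s" "s > 0" using y by (auto simp: strip_def)
        moreover have "ennreal (1 / Im z) \<le> ennreal (1 / s)"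
          using True \<open>s > 0\<close> by (intro ennreal_leI divide_left_mono) auto
        ultimately show ?thesis using True by (simp add: mult_right_mono)
      qed simp
    qed simp
    finally show "g z \<le> 2 * (\<integral>\<^sup>+s. ennreal (indicator {0<..} s / s) * (g z * indicator (strip s) z) \<partial>lborel)" .
  qed
  also have "\<dots> = 2 * (\<integral>\<^sup>+z. (\<integral>\<^sup>+s. ennreal (indicator {0<..} s / s) * (g z * indicator (strip s) z) \<partial>lborel) \<partial>\<mu>)"
    by (rule nn_integral_cmult) measurable
  also have "(\<integral>\<^sup>+z. (\<integral>\<^sup>+s. ennreal (indicator {0<..} s / s) * (g z * indicator (strip s) z) \<partial>lborel) \<partial>\<mu>)
      = (\<integral>\<^sup>+s. (\<integral>\<^sup>+z. ennreal (indicator {0<..} s / s) * (g z * indicator (strip s) z) \<partial>\<mu>) \<partial>lborel)"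
    by (rule P.Fubini') measurable
  also have "\<dots> = (\<integral>\<^sup>+s. ennreal (indicator {0<..} s / s) * (\<integral>\<^sup>+z. g z * indicator (strip s) z \<partial>\<mu>) \<partial>lborel)"
  proof (rule nn_integral_cong)
    fix s :: real
    show "(\<integral>\<^sup>+z. ennreal (indicator {0<..} s / s) * (g z * indicator (strip s) z) \<partial>\<mu>)
        = ennreal (indicator {0<..} s / s) * (\<integral>\<^sup>+z. g z * indicator (strip s) z \<partial>\<mu>)"
    proof (cases "0 < s")
      case True
      note [measurable] = strip_in_sets[OF True]
      show ?thesis by (rule nn_integral_cmult) measurable
    qed simp
  qed
  finally show ?thesis .
qed

text \<open>The constant collects the 2 from the decomposition into strips, \<open>C1\<close> from
  the large sieve inequality, and \<open>C2\<close>, \<open>C3\<close> from the weighted bounds at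
  \<open>r = p\<close> and \<open>r = p / 2\<close>. The norm \<open>N\<close> enters to the power
  \<open>q - p\<close> through the pointwise bound on \<open>B s\<close> and to the power
  \<open>p\<close> through the weighted bounds.\<close>

lemma laplace_embedding:
  assumes p: "2 < p" and pq: "p \<le> q" and a: "a = q * (p - 1) / p"
  obtains C where "C > 0"
    "\<And>h. h \<in> borel_measurable borel \<Longrightarrow> (\<And>t. t \<le> 0 \<Longrightarrow> h t = 0) \<Longrightarrow>
       integrable lborel (\<lambda>t. norm (h t) powr p) \<Longrightarrow>
       (\<integral>\<^sup>+z. ennreal (norm (LINT t|lborel. h t * laplace_kernel t z) powr q) \<partial>\<mu>)
         \<le> ennreal (C * ((LINT t|lborel. norm (h t) powr p) powr (1 / p)) powr q)"
proof -
  obtain C1 where C1: "C1 > 0" and L2: "\<And>h s. h \<in> borel_measurable borel \<Longrightarrow> (\<And>t. t \<le> 0 \<Longrightarrow> h t = 0) \<Longrightarrow> 0 < s \<Longrightarrow>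
       integrable lborel (\<lambda>t. norm (h t) * exp (- 2 * pi * s * t)) \<Longrightarrow>
       integrable lborel (\<lambda>t. (norm (h t))\<^sup>2 * exp (- 2 * pi * s * t)) \<Longrightarrow>
       (\<integral>\<^sup>+z. ennreal ((norm (LINT t|lborel. h t * laplace_kernel t z))\<^sup>2) * indicator (strip s) z \<partial>\<mu>)
         \<le> ennreal (C1 * s powr (a - 1) * (LINT t|lborel. (norm (h t))\<^sup>2 * exp (- 2 * pi * s * t)))"
    using strip_L2_bound by blast
  have "1 < p" "1 < p / 2" using p by auto
  obtain C2 where C2: "C2 > 0" and W2: "\<And>g :: real \<Rightarrow> real. g \<in> borel_measurable borel \<Longrightarrow> (\<And>t. 0 \<le> g t) \<Longrightarrow> (\<And>t. t \<le> 0 \<Longrightarrow> g t = 0) \<Longrightarrow>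
       (\<integral>\<^sup>+s. ennreal (indicator {0<..} s * ((LINT t|lborel. g t * exp (- 2 * pi * s * t)) powr p * s powr (p - 2))) \<partial>lborel)
         \<le> ennreal C2 * (\<integral>\<^sup>+t. ennreal (g t powr p) \<partial>lborel)"
    using real_laplace_weighted_bound[OF \<open>1 < p\<close>] by blast
  obtain C3 where C3: "C3 > 0" and W3: "\<And>g :: real \<Rightarrow> real. g \<in> borel_measurable borel \<Longrightarrow> (\<And>t. 0 \<le> g t) \<Longrightarrow> (\<And>t. t \<le> 0 \<Longrightarrow> g t = 0) \<Longrightarrow>
       (\<integral>\<^sup>+s. ennreal (indicator {0<..} s * ((LINT t|lborel. g t * exp (- 2 * pi * s * t)) powr (p / 2) * s powr (p / 2 - 2))) \<partial>lborel)
         \<le> ennreal C3 * (\<integral>\<^sup>+t. ennreal (g t powr (p / 2)) \<partial>lborel)"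
    using real_laplace_weighted_bound[OF \<open>1 < p / 2\<close>] by blast
  show thesis
  proof
    show "2 * C1 * (C2 + C3) > 0" using C1 C2 C3 by simp
    fix h :: "real \<Rightarrow> complex"
    assume h_meas [measurable]: "h \<in> borel_measurable borel" and h0: "\<And>t. t \<le> 0 \<Longrightarrow> h t = 0"
      and hp: "integrable lborel (\<lambda>t. norm (h t) powr p)"
    define F where "F z = (LINT t|lborel. h t * laplace_kernel t z)" for z
    define I where "I = (LINT t|lborel. norm (h t) powr p)"
    define N where "N = I powr (1 / p)"
    define A where "A s = (LINT t|lborel. (norm (h t))\<^sup>2 * exp (- 2 * pi * s * t))" for s
    define B where "B s = (LINT t|lborel. norm (h t) * exp (- 2 * pi * s * t))" for s
    have [measurable]: "F \<in> borel_measurable \<mu>"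
      unfolding F_def by (intro measurable_\<mu>_borel) measurable
    have [measurable]: "A \<in> borel_measurable borel" "B \<in> borel_measurable borel"
      unfolding A_def B_def by measurable
    have AB0: "A s \<ge> 0" "B s \<ge> 0" for s by (simp_all add: A_def B_def)
    have I0: "I \<ge> 0" by (simp add: I_def)
    have N0: "N \<ge> 0" by (simp add: N_def)
    have Np: "N powr p = I" using p I0 by (simp add: N_def powr_powr)
    have sq: "(norm (h t))\<^sup>2 powr (p / 2) = norm (h t) powr p" for t
      by (simp add: powr_powr flip: powr_numeral)
    have strip_bound: "ennreal (indicator {0<..} s / s) * (\<integral>\<^sup>+z. ennreal (norm (F z) powr q) * indicator (strip s) z \<partial>\<mu>)
        \<le> ennreal (C1 * N powr (q - p)) * (ennreal (indicator {0<..} s * (B s powr p * s powr (p - 2)))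
            + ennreal (indicator {0<..} s * (A s powr (p / 2) * s powr (p / 2 - 2))))" for s
    proof (cases "s > 0")
      case s: True
      have h1: "integrable lborel (\<lambda>t. norm (h t) * exp (- 2 * pi * s * t))"
        and B_le: "B s \<le> N * s powr (- ((p - 1) / p))"
        using Lp_times_exp[OF \<open>1 < p\<close> s, of "\<lambda>t. norm (h t)"] h0 hp
        by (auto simp: B_def N_def I_def)
      have h2: "integrable lborel (\<lambda>t. (norm (h t))\<^sup>2 * exp (- 2 * pi * s * t))"
        using Lp_times_exp(1)[OF \<open>1 < p / 2\<close> s, of "\<lambda>t. (norm (h t))\<^sup>2"] h0 hp
        by (auto simp: sq)
      note [measurable] = strip_in_sets[OF s]
      have "(\<integral>\<^sup>+z. ennreal (norm (F z) powr q) * indicator (strip s) z \<partial>\<mu>)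
          \<le> (\<integral>\<^sup>+z. ennreal (B s powr (q - 2)) * (ennreal ((norm (F z))\<^sup>2) * indicator (strip s) z) \<partial>\<mu>)"
      proof (rule nn_integral_mono)
        fix z
        show "ennreal (norm (F z) powr q) * indicator (strip s) z
            \<le> ennreal (B s powr (q - 2)) * (ennreal ((norm (F z))\<^sup>2) * indicator (strip s) z)"
        proof (cases "z \<in> strip s")
          case True
          then have "norm (F z) \<le> B s"
            unfolding F_def B_def by (intro norm_laplace_le h0 h1) (auto simp: strip_def)
          then have "norm (F z) powr (q - 2) \<le> B s powr (q - 2)"
            using p pq by (intro powr_mono2) auto
          moreover have "norm (F z) powr q = norm (F z) powr (q - 2) * (norm (F z))\<^sup>2"
            by (simp add: powr_add[symmetric] flip: powr_numeral)
          ultimately have "norm (F z) powr q \<le> B s powr (q - 2) * (norm (F z))\<^sup>2"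
            by (simp add: mult_right_mono)
          then show ?thesis using True by (simp add: ennreal_mult[symmetric] ennreal_leI)
        qed simp
      qed
      also have "\<dots> = ennreal (B s powr (q - 2)) * (\<integral>\<^sup>+z. ennreal ((norm (F z))\<^sup>2) * indicator (strip s) z \<partial>\<mu>)"
        by (rule nn_integral_cmult) measurable
      also have "\<dots> \<le> ennreal (B s powr (q - 2)) * ennreal (C1 * s powr (a - 1) * A s)"
        unfolding F_def A_def by (intro mult_left_mono L2 h_meas h0 s h1 h2) auto
      also have "\<dots> = ennreal (B s powr (q - 2) * (C1 * s powr (a - 1) * A s))"
        using C1 AB0 by (simp add: ennreal_mult)
      also have "\<dots> \<le> ennreal (C1 * N powr (q - p) * (s * (B s powr p * s powr (p - 2) + A s powr (p / 2) * s powr (p / 2 - 2))))"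
      proof (rule ennreal_leI)
        \<comment> \<open>Only \<open>q - p\<close> of the factors are estimated pointwise; the
          other \<open>p - 2\<close> are kept for Young's inequality, which leads back to an
          integral over \<open>s\<close>.\<close>
        have "B s powr (q - 2) = B s powr (q - p) * B s powr (p - 2)"
          by (simp flip: powr_add)
        also have "\<dots> \<le> (N * s powr (- ((p - 1) / p))) powr (q - p) * B s powr (p - 2)"
          using B_le AB0 pq by (intro mult_right_mono powr_mono2) auto
        finally have "B s powr (q - 2) * (C1 * s powr (a - 1) * A s)
            \<le> (N * s powr (- ((p - 1) / p))) powr (q - p) * B s powr (p - 2) * (C1 * s powr (a - 1) * A s)"
          using C1 AB0 by (intro mult_right_mono) auto
        also have "\<dots> = C1 * N powr (q - p) * ((s powr (- ((p - 1) / p * (q - p))) * s powr (a - 1)) * B s powr (p - 2) * A s)"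
          by (simp add: powr_mult powr_powr)
        \<comment> \<open>The terms with \<open>q\<close> cancel because of the Carleson exponent
          \<open>a = q * (p - 1) / p\<close>, and \<open>(p - 1) - 1\<close> remains.\<close>
        also have "s powr (- ((p - 1) / p * (q - p))) * s powr (a - 1) = s powr (p - 2)"
        proof -
          have "- ((p - 1) / p * (q - p)) + (a - 1) = p - 2" using p by (simp add: a field_simps)
          then show ?thesis by (simp only: powr_add[symmetric])
        qed
        also have "C1 * N powr (q - p) * (s powr (p - 2) * B s powr (p - 2) * A s)
            \<le> C1 * N powr (q - p) * (s * (B s powr p * s powr (p - 2) + A s powr (p / 2) * s powr (p / 2 - 2)))"
          using C1 by (intro mult_left_mono Young_splitting p AB0 s) auto
        finally show "B s powr (q - 2) * (C1 * s powr (a - 1) * A s)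
            \<le> C1 * N powr (q - p) * (s * (B s powr p * s powr (p - 2) + A s powr (p / 2) * s powr (p / 2 - 2)))" .
      qed
      finally have "ennreal (1 / s) * (\<integral>\<^sup>+z. ennreal (norm (F z) powr q) * indicator (strip s) z \<partial>\<mu>)
          \<le> ennreal (1 / s) * ennreal (C1 * N powr (q - p) * (s * (B s powr p * s powr (p - 2) + A s powr (p / 2) * s powr (p / 2 - 2))))"
        by (rule mult_left_mono) simp
      also have "\<dots> = ennreal (C1 * N powr (q - p) * (B s powr p * s powr (p - 2) + A s powr (p / 2) * s powr (p / 2 - 2)))"
        using s C1 by (subst ennreal_mult[symmetric]) auto
      also have "\<dots> = ennreal (C1 * N powr (q - p)) * (ennreal (B s powr p * s powr (p - 2)) + ennreal (A s powr (p / 2) * s powr (p / 2 - 2)))"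
        using C1 by (subst ennreal_mult) auto
      finally show ?thesis using s by simp
    qed simp
    have nn_I: "(\<integral>\<^sup>+t. ennreal (norm (h t) powr p) \<partial>lborel) = ennreal I"
      unfolding I_def by (rule nn_integral_eq_integral[OF hp]) simp
    have "(\<integral>\<^sup>+z. ennreal (norm (F z) powr q) \<partial>\<mu>)
        \<le> 2 * (\<integral>\<^sup>+s. ennreal (indicator {0<..} s / s) * (\<integral>\<^sup>+z. ennreal (norm (F z) powr q) * indicator (strip s) z \<partial>\<mu>) \<partial>lborel)"
      by (rule nn_integral_le_strips) measurable
    also have "\<dots> \<le> 2 * (\<integral>\<^sup>+s. ennreal (C1 * N powr (q - p)) * (ennreal (indicator {0<..} s * (B s powr p * s powr (p - 2)))
            + ennreal (indicator {0<..} s * (A s powr (p / 2) * s powr (p / 2 - 2)))) \<partial>lborel)"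
      by (intro mult_left_mono nn_integral_mono strip_bound) simp
    also have "\<dots> = 2 * (ennreal (C1 * N powr (q - p)) * ((\<integral>\<^sup>+s. ennreal (indicator {0<..} s * (B s powr p * s powr (p - 2))) \<partial>lborel)
            + (\<integral>\<^sup>+s. ennreal (indicator {0<..} s * (A s powr (p / 2) * s powr (p / 2 - 2))) \<partial>lborel)))"
      by (simp add: nn_integral_cmult nn_integral_add)
    also have "\<dots> \<le> 2 * (ennreal (C1 * N powr (q - p)) * (ennreal C2 * ennreal I + ennreal C3 * ennreal I))"
    proof (intro mult_left_mono add_mono)
      show "(\<integral>\<^sup>+s. ennreal (indicator {0<..} s * (B s powr p * s powr (p - 2))) \<partial>lborel) \<le> ennreal C2 * ennreal I"
        unfolding B_def nn_I[symmetric] by (rule W2) (auto simp: h0)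
      have "(\<integral>\<^sup>+s. ennreal (indicator {0<..} s * (A s powr (p / 2) * s powr (p / 2 - 2))) \<partial>lborel)
          \<le> ennreal C3 * (\<integral>\<^sup>+t. ennreal ((norm (h t))\<^sup>2 powr (p / 2)) \<partial>lborel)"
        unfolding A_def by (rule W3) (auto simp: h0)
      then show "(\<integral>\<^sup>+s. ennreal (indicator {0<..} s * (A s powr (p / 2) * s powr (p / 2 - 2))) \<partial>lborel) \<le> ennreal C3 * ennreal I"
        by (simp only: sq nn_I)
    qed auto
    also have "\<dots> = ennreal (2 * C1 * (C2 + C3) * (N powr (q - p) * I))"
    proof -
      have "ennreal C2 * ennreal I + ennreal C3 * ennreal I = ennreal (C2 * I + C3 * I)"
        using C2 C3 I0 by (simp add: ennreal_mult)
      moreover have "2 * (ennreal (C1 * N powr (q - p)) * ennreal (C2 * I + C3 * I)) = ennreal (2 * (C1 * N powr (q - p) * (C2 * I + C3 * I)))"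
        using C1 C2 C3 I0 by (simp add: ennreal_mult)
      ultimately show ?thesis by (simp add: algebra_simps)
    qed
    also have "N powr (q - p) * I = N powr q"
      unfolding Np[symmetric] by (simp flip: powr_add)
    finally show "(\<integral>\<^sup>+z. ennreal (norm (LINT t|lborel. h t * laplace_kernel t z) powr q) \<partial>\<mu>)
         \<le> ennreal (2 * C1 * (C2 + C3) * ((LINT t|lborel. norm (h t) powr p) powr (1 / p)) powr q)"
      unfolding F_def N_def I_def .
  qed
qed

end

section \<open>Borel representatives and the embedding theorem\<close>

text \<open>Elements of the space on the half-line are only Lebesgue measurable, whereas the
  arguments on product spaces above use Borel functions. Real and imaginary parts of the extension
  by 0 are changed on a null set, and the value 0 off the half-line is then restored.\<close>

lemma borel_representative_halfline:
  fixes f :: "real \<Rightarrow> complex"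
  assumes f: "f \<in> borel_measurable (lebesgue_on {0<..})"
  obtains h where "h \<in> borel_measurable borel" "\<And>t. t \<le> 0 \<Longrightarrow> h t = 0"
    "AE t in lborel. 0 < t \<longrightarrow> h t = f t"
proof -
  define f0 where "f0 t = (if t \<in> {0<..} then f t else 0)" for t
  have f0: "f0 \<in> borel_measurable lebesgue"
    using f unfolding f0_def by (subst borel_measurable_if) auto
  have "(\<lambda>t. Re (f0 t)) \<in> borel_measurable lebesgue" "(\<lambda>t. Im (f0 t)) \<in> borel_measurable lebesgue"
    using f0 by measurable
  then obtain u v where [measurable]: "u \<in> borel_measurable lborel" "v \<in> borel_measurable lborel"
    and uv: "AE t in lborel. Re (f0 t) = u t" "AE t in lborel. Im (f0 t) = v t"
    using completion_ex_borel_measurable_real by metis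
  show thesis
  proof
    show "(\<lambda>t. if 0 < t then Complex (u t) (v t) else 0) \<in> borel_measurable borel"
      unfolding Complex_eq by measurable
    show "AE t in lborel. 0 < t \<longrightarrow> (if 0 < t then Complex (u t) (v t) else 0) = f t"
      using uv by eventually_elim (auto simp: f0_def complex_eq_iff)
  qed auto
qed

text \<open>The general \<open>G\<close> covers both the Laplace integrand and the power of the
  modulus. The condition \<open>G 0 t = 0\<close> makes extension by 0 compatible with restricting
  the integral; the null set and the completion of the measure do not affect integrals.\<close>

lemma lebesgue_on_halfline_transfer:
  fixes G :: "complex \<Rightarrow> real \<Rightarrow> 'b::{banach, second_countable_topology}"
  assumes f: "f \<in> borel_measurable (lebesgue_on {0<..})"
    and h: "h \<in> borel_measurable borel" "\<And>t. t \<le> 0 \<Longrightarrow> h t = 0" "AE t in lborel. 0 < t \<longrightarrow> h t = f t"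
    and G [measurable]: "case_prod G \<in> borel_measurable borel" and G0: "\<And>t. G 0 t = 0"
  shows "integrable (lebesgue_on {0<..}) (\<lambda>t. G (f t) t) \<longleftrightarrow> integrable lborel (\<lambda>t. G (h t) t)"
    and "(LINT t|lebesgue_on {0<..}. G (f t) t) = (LINT t|lborel. G (h t) t)"
proof -
  define f0 where "f0 t = (if t \<in> {0<..} then f t else 0)" for t
  have f0 [measurable]: "f0 \<in> borel_measurable lebesgue"
    using f unfolding f0_def by (subst borel_measurable_if) auto
  have hm [measurable]: "h \<in> borel_measurable borel" by fact
  have h': "h \<in> borel_measurable lebesgue" using h(1) by (intro measurable_completion) simp
  have ind: "indicator {0<..} t *\<^sub>R G (f t) t = G (f0 t) t" for t
    by (auto simp: f0_def G0)
  have G_comp: "(\<lambda>t. G (k t) t) \<in> borel_measurable lebesgue" if "k \<in> borel_measurable lebesgue" for k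
  proof -
    have "(\<lambda>t. (k t, t)) \<in> borel_measurable lebesgue"
      using that by (intro borel_measurable_Pair) (auto intro: measurable_completion)
    from measurable_compose[OF this G] show ?thesis by simp
  qed
  have "AE t in lborel. G (f0 t) t = G (h t) t"
    using h(3) by eventually_elim (auto simp: f0_def h(2))
  then have ae: "AE t in lebesgue. G (f0 t) t = G (h t) t" by (rule AE_completion)
  have Gh: "(\<lambda>t. G (h t) t) \<in> borel_measurable lborel"
  proof -
    have "(\<lambda>t. (h t, t)) \<in> borel_measurable lborel" by (intro borel_measurable_Pair) auto
    from measurable_compose[OF this G] show ?thesis by simp
  qed
  show "integrable (lebesgue_on {0<..}) (\<lambda>t. G (f t) t) \<longleftrightarrow> integrable lborel (\<lambda>t. G (h t) t)"
    using integrable_cong_AE[OF G_comp[OF f0] G_comp[OF h'] ae] integrable_completion[OF Gh]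
    by (subst integrable_restrict_space) (auto simp: ind)
  show "(LINT t|lebesgue_on {0<..}. G (f t) t) = (LINT t|lborel. G (h t) t)"
    using integral_cong_AE[OF G_comp[OF f0] G_comp[OF h'] ae] integral_completion[OF Gh]
    by (subst integral_restrict_space) (auto simp: ind)
qed

theorem theorem1p1:
  fixes p q :: real and \<mu> :: "complex measure"
  assumes "2 < p" and "p \<le> q"
    and "sets \<mu> = sets (restrict_space borel upper_half_plane)"
    and "\<exists>C0>0. \<forall>I::real set. is_interval I \<and> bounded I \<longrightarrow>
           emeasure \<mu> (carleson_box I)
             \<le> ennreal (C0 * measure lborel I powr (q / conjugate_exponent p))"
  shows "\<exists>C>0. \<forall>f \<in> Lp_space p (lebesgue_on {0<..}).
           laplace_transform f \<in> Lp_space q \<mu> \<and>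
           Lp_norm q \<mu> (laplace_transform f) \<le> C * Lp_norm p (lebesgue_on {0<..}) f"
proof -
  obtain C0 where "C0 > 0" and "\<And>I::real set. is_interval I \<Longrightarrow> bounded I \<Longrightarrow>
           emeasure \<mu> (carleson_box I) \<le> ennreal (C0 * measure lborel I powr (q / conjugate_exponent p))"
    using assms(4) by blast
  then interpret carleson_measure \<mu> "q / conjugate_exponent p" C0
    using assms(3) by unfold_locales auto
  have q: "q > 0" using assms(1,2) by simp
  have exponent: "q / conjugate_exponent p = q * (p - 1) / p"
    by (simp add: conjugate_exponent_def)
  obtain C where C: "C > 0" and bound: "\<And>h. h \<in> borel_measurable borel \<Longrightarrow> (\<And>t. t \<le> 0 \<Longrightarrow> h t = 0) \<Longrightarrow>
       integrable lborel (\<lambda>t. norm (h t) powr p) \<Longrightarrow>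
       (\<integral>\<^sup>+z. ennreal (norm (LINT t|lborel. h t * laplace_kernel t z) powr q) \<partial>\<mu>)
         \<le> ennreal (C * ((LINT t|lborel. norm (h t) powr p) powr (1 / p)) powr q)"
    using laplace_embedding[OF assms(1,2) exponent] by blast
  show ?thesis
  \<comment> \<open>The \<open>q\<close>-th root of the constant, since \<open>bound\<close>
    concerns \<open>q\<close>-th powers.\<close>
  proof (intro exI[of _ "C powr (1 / q)"] conjI ballI)
    show "C powr (1 / q) > 0" using C by simp
    fix f :: "real \<Rightarrow> complex" assume "f \<in> Lp_space p (lebesgue_on {0<..})"
    then have f: "f \<in> borel_measurable (lebesgue_on {0<..})"
      and fp: "integrable (lebesgue_on {0<..}) (\<lambda>t. norm (f t) powr p)"
      by (auto simp: Lp_space_def)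
    obtain h where h: "h \<in> borel_measurable borel" "\<And>t. t \<le> 0 \<Longrightarrow> h t = 0" "AE t in lborel. 0 < t \<longrightarrow> h t = f t"
      using borel_representative_halfline[OF f] by blast
    have [measurable]: "h \<in> borel_measurable borel" by fact
    \<comment> \<open>This holds at every \<open>z\<close>, not merely almost everywhere, since the
      integral over \<open>t\<close> ignores the change of representative.\<close>
    have L: "laplace_transform f z = (LINT t|lborel. h t * laplace_kernel t z)" for z
      unfolding laplace_transform_def
      using lebesgue_on_halfline_transfer(2)[OF f h, of "\<lambda>x t. x * laplace_kernel t z"]
      by (simp add: borel_prod[symmetric])
    have hp: "integrable lborel (\<lambda>t. norm (h t) powr p)"
      using lebesgue_on_halfline_transfer(1)[OF f h, of "\<lambda>x t. norm x powr p"] fp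
      by (simp add: borel_prod[symmetric])
    have norm_f: "Lp_norm p (lebesgue_on {0<..}) f = (LINT t|lborel. norm (h t) powr p) powr (1 / p)"
      unfolding Lp_norm_def
      using lebesgue_on_halfline_transfer(2)[OF f h, of "\<lambda>x t. norm x powr p"]
      by (simp add: borel_prod[symmetric])
    have meas [measurable]: "laplace_transform f \<in> borel_measurable \<mu>"
      unfolding L[abs_def] by (intro measurable_\<mu>_borel) measurable
    define K where "K = C * Lp_norm p (lebesgue_on {0<..}) f powr q"
    have K: "K \<ge> 0" using C by (simp add: K_def)
    have le: "(\<integral>\<^sup>+z. ennreal (norm (laplace_transform f z) powr q) \<partial>\<mu>) \<le> ennreal K"
      using bound[OF h(1,2) hp] by (simp add: L K_def norm_f)
    \<comment> \<open>Finiteness of the nonnegative integral gives membership in the space, so that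
      \<open>Lp_norm\<close> below is a true norm and not the default value 0.\<close>
    have int: "integrable \<mu> (\<lambda>z. norm (laplace_transform f z) powr q)"
      using le by (intro integrableI_nonneg) (auto simp: less_top[symmetric] top_unique)
    then show "laplace_transform f \<in> Lp_space q \<mu>"
      using meas by (simp add: Lp_space_def)
    have "ennreal (LINT z|\<mu>. norm (laplace_transform f z) powr q) \<le> ennreal K"
      using le by (simp add: nn_integral_eq_integral[OF int])
    then have "(LINT z|\<mu>. norm (laplace_transform f z) powr q) \<le> K"
      using K by simp
    then have "Lp_norm q \<mu> (laplace_transform f) \<le> K powr (1 / q)"
      unfolding Lp_norm_def using q by (intro powr_mono2) auto
    also have "\<dots> = C powr (1 / q) * Lp_norm p (lebesgue_on {0<..}) f"
      using q by (simp add: K_def powr_mult powr_powr Lp_norm_def)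
    finally show "Lp_norm q \<mu> (laplace_transform f) \<le> C powr (1 / q) * Lp_norm p (lebesgue_on {0<..}) f" .
  qed
qed

end
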